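(* Let $\mathcal{E}: \mathbf{1} \to \mathcal{K} \to \mathcal{H} \xrightarrow{(\pi_1,\pi_2)} \mathcal{A} \to \mathbf{1}$ be an abelian extension of a relative Rota--Baxter group $\mathcal{A}=(A,B,\beta,T)$ by a trivial relative Rota--Baxter group $\mathcal{K}=(K,L,\alpha,S)$, with associated action $(\nu,\mu,\sigma,f)$ and with associated cohomology class $[(\tau_1,\tau_2,\rho,\chi)]\in\mathrm{H}^2_{RRB}(\mathcal{A},\mathcal{K})$. A pair of automorphisms $(\psi,\theta)\in\mathrm{Aut}(\mathcal{A})\times\mathrm{Aut}(\mathcal{K})$ is inducible if and only if the following conditions hold: (1) $\theta=(\theta_1,\theta_2):\mathcal{K}\to\mathcal{K}_\psi$ is an isomorphism of $\mathcal{A}$-modules; (2) $\theta^*([(\tau_1,\tau_2,\rho,\chi)])=\psi^*([(\tau_1,\tau_2,\rho,\chi)])$ in $\mathrm{H}^2_{RRB}(\mathcal{A},\mathcal{K}_\psi)$.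
   Context: **Relative Rota--Baxter groups.** A relative Rota--Baxter group is a quadruple $(H,G,\phi,R)$ where $H,G$ are groups, $\phi:G\to\mathrm{Aut}(H)$, $g\mapsto\phi_g$, is a homomorphism and $R:H\to G$ is a map with $R(h_1)R(h_2)=R(h_1\phi_{R(h_1)}(h_2))$ for all $h_1,h_2\in H$. It is trivial if $\phi$ is the trivial homomorphism (then $R$ is a homomorphism). A homomorphism $(H,G,\phi,R)\to(K,L,\varphi,S)$ is a pair $(\psi,\eta)$ of group homomorphisms $\psi:H\to K$, $\eta:G\to L$ with $\eta R=S\psi$ and $\psi\phi_g=\varphi_{\eta(g)}\psi$ for all $g\in G$; it is an isomorphism if both are group isomorphisms. $\mathrm{Aut}(\cdot)$ denotes the automorphism group. **Abelian extensions.** An extension of $\mathcal{A}=(A,B,\beta,T)$ by $\mathcal{K}=(K,L,\alpha,S)$ is a sequence $\mathbf 1\to\mathcal{K}\xrightarrow{(i_1,i_2)}\mathcal{H}=(H,G,\phi,R)\xrightarrow{(\pi_1,\pi_2)}\mathcal{A}\to\mathbf 1$ of homomorphisms of relative Rota--Baxter groups with $i_1,i_2$ injective, $\pi_1,\pi_2$ surjective, $\mathrm{im}(i_1)=\ker\pi_1$ and $\mathrm{im}(i_2)=\ker\pi_2$. It is abelian if $K,L$ are abelian and $\mathcal{K}$ is trivial. $K,L$ are identified with their images under $i_1,i_2$. All groups are written multiplicatively. **Associated action and cocycle.** Let $s_H:A\to H$, $s_G:B\to G$ be set-theoretic sections of $\pi_1,\pi_2$ with $s_H(1)=1$, $s_G(1)=1$.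 The action associated with $\mathcal{E}$ is the quadruple $(\nu,\mu,\sigma,f)$ with $\nu:B\to\mathrm{Aut}(K)$, $\mu:A\to\mathrm{Aut}(K)$, $\sigma:B\to\mathrm{Aut}(L)$, $f:L\times A\to K$: $\nu_b(k)=\phi_{s_G(b)}(k)$, $\mu_a(k)=s_H(a)^{-1}ks_H(a)$, $\sigma_b(l)=s_G(b)^{-1}l\,s_G(b)$, $f(l,a)=s_H(a)^{-1}\phi_l(s_H(a))$; these do not depend on the sections, and they make $\mathcal{K}$ an $\mathcal{A}$-module. The cohomology class associated with $\mathcal{E}$ is the class (independent of the sections) of the quadruple $\tau_1(a_1,a_2)=s_H(a_1a_2)^{-1}s_H(a_1)s_H(a_2)$, $\tau_2(b_1,b_2)=s_G(b_1b_2)^{-1}s_G(b_1)s_G(b_2)$, $\rho(a,b)=s_H(\beta_b(a))^{-1}\phi_{s_G(b)}(s_H(a))$, $\chi(a)=s_G(T(a))^{-1}R(s_H(a))$. **Second cohomology.** Let $\mathrm C^2_{RRB}$ be the group (pointwise multiplication) of quadruples of maps $(\tau_1,\tau_2,\rho,\chi)$, $\tau_1:A\times A\to K$, $\tau_2:B\times B\to L$, $\rho:A\times B\to K$, $\chi:A\to L$, each taking value $1$ whenever some argument is the identity. Write $a_1\circ_Ta_2=a_1\beta_{T(a_1)}(a_2)$. $\mathrm Z^2_{RRB}(\mathcal{A},\mathcal{K})$ is the subgroup of quadruples satisfying for all $a_i\in A$, $b_i\in B$: (i) $\tau_1(a_2,a_3)\tau_1(a_1,a_2a_3)=\tau_1(a_1a_2,a_3)\mu_{a_3}(\tau_1(a_1,a_2))$;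 (ii) $\tau_2(b_2,b_3)\tau_2(b_1,b_2b_3)=\tau_2(b_1b_2,b_3)\sigma_{b_3}(\tau_2(b_1,b_2))$; (iii) $\rho(\beta_{b_2}(a_1),b_1)\nu_{b_1}(\rho(a_1,b_2))=\rho(a_1,b_1b_2)\nu_{b_1b_2}(f(\tau_2(b_1,b_2),a_1))$; (iv) $\rho(a_1a_2,b_1)\nu_{b_1}(\tau_1(a_1,a_2))=\mu_{\beta_{b_1}(a_2)}(\rho(a_1,b_1))\rho(a_2,b_1)\tau_1(\beta_{b_1}(a_1),\beta_{b_1}(a_2))$; (v) $\tau_2(T(a_1),T(a_2))\,\chi(a_2)\chi(a_1\circ_Ta_2)^{-1}\sigma_{T(a_2)}(\chi(a_1))=S\big(\nu^{-1}_{T(a_1\circ_Ta_2)}\big(\rho(a_2,T(a_1))\,\tau_1(a_1,\beta_{T(a_1)}(a_2))\,\nu_{T(a_1)}(f(\chi(a_1),a_2))\big)\big)$. $\mathrm B^2_{RRB}(\mathcal{A},\mathcal{K})$ is the subgroup of those $(\tau_1,\tau_2,\rho,\chi)\in\mathrm Z^2_{RRB}$ for which there are maps $\kappa_1:A\to K$, $\kappa_2:B\to L$ with $\kappa_i(1)=1$ and $\tau_1(a_1,a_2)=\kappa_1(a_1a_2)^{-1}\kappa_1(a_2)\mu_{a_2}(\kappa_1(a_1))$, $\tau_2(b_1,b_2)=\kappa_2(b_1b_2)^{-1}\kappa_2(b_2)\sigma_{b_2}(\kappa_2(b_1))$, $\rho(a,b)=\nu_b(f(\kappa_2(b),a)\kappa_1(a))\kappa_1(\beta_b(a))^{-1}$,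 $\chi(a)=S(\nu^{-1}_{T(a)}(\kappa_1(a)))\kappa_2(T(a))^{-1}$. $\mathrm H^2_{RRB}(\mathcal{A},\mathcal{K})=\mathrm Z^2_{RRB}/\mathrm B^2_{RRB}$. **The module $\mathcal{K}_\psi$.** For $\psi=(\psi_1,\psi_2)\in\mathrm{Aut}(\mathcal{A})$, $\mathcal{K}_\psi$ denotes $\mathcal{K}$ with the new $\mathcal{A}$-module structure given by the quadruple $(\nu\psi_2,\mu\psi_1,\sigma\psi_2,f\psi_1)$, i.e. $b\mapsto\nu_{\psi_2(b)}$, $a\mapsto\mu_{\psi_1(a)}$, $b\mapsto\sigma_{\psi_2(b)}$, $(l,a)\mapsto f(l,\psi_1(a))$. $\mathrm H^2_{RRB}(\mathcal{A},\mathcal{K}_\psi)$ is defined by the formulas above with this quadruple in place of $(\nu,\mu,\sigma,f)$. For $\theta=(\theta_1,\theta_2)\in\mathrm{Aut}(\mathcal{K})$, "$\theta:\mathcal{K}\to\mathcal{K}_\psi$ is an isomorphism of $\mathcal{A}$-modules" means that for all $a\in A,b\in B,k\in K,l\in L$: $\theta_1(\nu_b(k))=\nu_{\psi_2(b)}(\theta_1(k))$, $\theta_1(\mu_a(k))=\mu_{\psi_1(a)}(\theta_1(k))$, $\theta_2(\sigma_b(l))=\sigma_{\psi_2(b)}(\theta_2(l))$, $\theta_1(f(l,a))=f(\theta_2(l),\psi_1(a))$. **Induced maps.** $\psi$ induces an isomorphism $\psi^*:\mathrm H^2_{RRB}(\mathcal{A},\mathcal{K})\to\mathrm H^2_{RRB}(\mathcal{A},\mathcal{K}_\psi)$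 sending $[(\tau_1,\tau_2,\rho,\chi)]$ to the class of $\big(\tau_1(\psi_1(\cdot),\psi_1(\cdot)),\ \tau_2(\psi_2(\cdot),\psi_2(\cdot)),\ \rho(\psi_1(\cdot),\psi_2(\cdot)),\ \chi(\psi_1(\cdot))\big)$. An $\mathcal{A}$-module isomorphism $\theta:\mathcal{K}\to\mathcal{K}_\psi$ induces an isomorphism $\theta^*:\mathrm H^2_{RRB}(\mathcal{A},\mathcal{K})\to\mathrm H^2_{RRB}(\mathcal{A},\mathcal{K}_\psi)$ sending $[(\tau_1,\tau_2,\rho,\chi)]$ to $[(\theta_1\circ\tau_1,\theta_2\circ\tau_2,\theta_1\circ\rho,\theta_2\circ\chi)]$. (Condition (2) is considered under condition (1), which makes $\theta^*$ defined.) **Inducible pairs.** $\mathrm{Aut}_{\mathcal{K}}(\mathcal{H})$ is the subgroup of $\gamma=(\gamma_1,\gamma_2)\in\mathrm{Aut}(\mathcal{H})$ normalizing $\mathcal{K}$, i.e. $\gamma_1(K)=K$ and $\gamma_2(L)=L$. For such $\gamma$ let $\gamma_{\mathcal{K}}=(\gamma_1|_K,\gamma_2|_L)$ and let $\gamma_{\mathcal{A}}$ be the induced automorphism of $\mathcal{A}$, with components $a\mapsto\pi_1(\gamma_1(s_H(a)))$ and $b\mapsto\pi_2(\gamma_2(s_G(b)))$. A pair $(\psi,\theta)\in\mathrm{Aut}(\mathcal{A})\times\mathrm{Aut}(\mathcal{K})$ is inducible if $(\psi,\theta)=(\gamma_{\mathcal{A}},\gamma_{\mathcal{K}})$ for some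 $\gamma\in\mathrm{Aut}_{\mathcal{K}}(\mathcal{H})$. *)

theory Defs
  imports "HOL-Algebra.Bij" "HOL-Algebra.Coset"
begin

text \<open>A relative Rota--Baxter group is a quadruple \<open>(H, G, \<phi>, R)\<close>; \<open>rphi X g\<close> is the map \<open>\<phi>\<^sub>g\<close>.\<close>

record ('h, 'g) rrb =
  rH :: "'h monoid"
  rG :: "'g monoid"
  rphi :: "'g \<Rightarrow> 'h \<Rightarrow> 'h"
  rR :: "'h \<Rightarrow> 'g"

definition rrb_group :: "('h, 'g) rrb \<Rightarrow> bool" where
  "rrb_group X \<longleftrightarrow>
     group (rH X) \<and> group (rG X) \<and>
     rphi X \<in> hom (rG X) (AutoGroup (rH X)) \<and>
     rR X \<in> carrier (rH X) \<rightarrow> carrier (rG X) \<and>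
     (\<forall>h\<^sub>1 \<in> carrier (rH X). \<forall>h\<^sub>2 \<in> carrier (rH X).
        rR X h\<^sub>1 \<otimes>\<^bsub>rG X\<^esub> rR X h\<^sub>2 = rR X (h\<^sub>1 \<otimes>\<^bsub>rH X\<^esub> rphi X (rR X h\<^sub>1) h\<^sub>2))"

definition rrb_trivial :: "('h, 'g) rrb \<Rightarrow> bool" where
  "rrb_trivial X \<longleftrightarrow> trivial_homomorphism (rG X) (AutoGroup (rH X)) (rphi X)"

definition rrb_hom :: "('h, 'g) rrb \<Rightarrow> ('k, 'l) rrb \<Rightarrow> (('h \<Rightarrow> 'k) \<times> ('g \<Rightarrow> 'l)) set" where
  "rrb_hom X Y = {(\<psi>, \<eta>).
     \<psi> \<in> hom (rH X) (rH Y) \<and> \<eta> \<in> hom (rG X) (rG Y) \<and>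
     (\<forall>h \<in> carrier (rH X). \<eta> (rR X h) = rR Y (\<psi> h)) \<and>
     (\<forall>g \<in> carrier (rG X). \<forall>h \<in> carrier (rH X). \<psi> (rphi X g h) = rphi Y (\<eta> g) (\<psi> h))}"

text \<open>As for \<open>auto\<close>, the components are extensional, so that equality of
  automorphisms is equality of functions.\<close>

definition rrb_auto :: "('h, 'g) rrb \<Rightarrow> (('h \<Rightarrow> 'h) \<times> ('g \<Rightarrow> 'g)) set" where
  "rrb_auto X = rrb_hom X X \<inter> (auto (rH X) \<times> auto (rG X))"

text \<open>An extension of \<open>eA E\<close> by \<open>eK E\<close> with middle term \<open>eH E\<close>. The groups \<open>K\<close> and \<open>L\<close> are
  kept apart from their images in \<open>H\<close> and \<open>G\<close>; the usual identification is made
  explicit by the pull-backs \<open>ret1\<close> and \<open>ret2\<close> along \<open>i\<^sub>1\<close> and \<open>i\<^sub>2\<close>.\<close>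

record ('k, 'l, 'h, 'g, 'a, 'b) rrb_ext =
  eK :: "('k, 'l) rrb"
  eH :: "('h, 'g) rrb"
  eA :: "('a, 'b) rrb"
  inc1 :: "'k \<Rightarrow> 'h"
  inc2 :: "'l \<Rightarrow> 'g"
  proj1 :: "'h \<Rightarrow> 'a"
  proj2 :: "'g \<Rightarrow> 'b"

definition rrb_extension :: "('k, 'l, 'h, 'g, 'a, 'b) rrb_ext \<Rightarrow> bool" where
  "rrb_extension E \<longleftrightarrow>
     rrb_group (eK E) \<and> rrb_group (eH E) \<and> rrb_group (eA E) \<and>
     (inc1 E, inc2 E) \<in> rrb_hom (eK E) (eH E) \<and>
     (proj1 E, proj2 E) \<in> rrb_hom (eH E) (eA E) \<and>
     inj_on (inc1 E) (carrier (rH (eK E))) \<and>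
     inj_on (inc2 E) (carrier (rG (eK E))) \<and>
     proj1 E ` carrier (rH (eH E)) = carrier (rH (eA E)) \<and>
     proj2 E ` carrier (rG (eH E)) = carrier (rG (eA E)) \<and>
     inc1 E ` carrier (rH (eK E)) = kernel (rH (eH E)) (rH (eA E)) (proj1 E) \<and>
     inc2 E ` carrier (rG (eK E)) = kernel (rG (eH E)) (rG (eA E)) (proj2 E)"

definition abelian_rrb_extension :: "('k, 'l, 'h, 'g, 'a, 'b) rrb_ext \<Rightarrow> bool" where
  "abelian_rrb_extension E \<longleftrightarrow>
     rrb_extension E \<and> comm_group (rH (eK E)) \<and> comm_group (rG (eK E)) \<and> rrb_trivial (eK E)"

definition ret1 :: "('k, 'l, 'h, 'g, 'a, 'b) rrb_ext \<Rightarrow> 'h \<Rightarrow> 'k" where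
  "ret1 E = inv_into (carrier (rH (eK E))) (inc1 E)"

definition ret2 :: "('k, 'l, 'h, 'g, 'a, 'b) rrb_ext \<Rightarrow> 'g \<Rightarrow> 'l" where
  "ret2 E = inv_into (carrier (rG (eK E))) (inc2 E)"

definition normalized_sections ::
    "('k, 'l, 'h, 'g, 'a, 'b) rrb_ext \<Rightarrow> ('a \<Rightarrow> 'h) \<Rightarrow> ('b \<Rightarrow> 'g) \<Rightarrow> bool" where
  "normalized_sections E sH sG \<longleftrightarrow>
     sH \<in> carrier (rH (eA E)) \<rightarrow> carrier (rH (eH E)) \<and>
     sG \<in> carrier (rG (eA E)) \<rightarrow> carrier (rG (eH E)) \<and>
     (\<forall>a \<in> carrier (rH (eA E)). proj1 E (sH a) = a) \<and>
     (\<forall>b \<in> carrier (rG (eA E)). proj2 E (sG b) = b) \<and>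
     sH \<one>\<^bsub>rH (eA E)\<^esub> = \<one>\<^bsub>rH (eH E)\<^esub> \<and>
     sG \<one>\<^bsub>rG (eA E)\<^esub> = \<one>\<^bsub>rG (eH E)\<^esub>"

text \<open>The quadruple \<open>(\<nu>, \<mu>, \<sigma>, f)\<close>. As conjugation is \<open>k \<mapsto> s\<^sup>-\<^sup>1 k s\<close>, the maps
  \<open>a \<mapsto> \<mu>\<^sub>a\<close> and \<open>b \<mapsto> \<sigma>\<^sub>b\<close> of an extension reverse products.\<close>

record ('a, 'b, 'k, 'l) rrb_action =
  act_nu :: "'b \<Rightarrow> 'k \<Rightarrow> 'k"
  act_mu :: "'a \<Rightarrow> 'k \<Rightarrow> 'k"
  act_sigma :: "'b \<Rightarrow> 'l \<Rightarrow> 'l"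
  act_f :: "'l \<Rightarrow> 'a \<Rightarrow> 'k"

definition ext_action ::
    "('k, 'l, 'h, 'g, 'a, 'b) rrb_ext \<Rightarrow> ('a \<Rightarrow> 'h) \<Rightarrow> ('b \<Rightarrow> 'g) \<Rightarrow> ('a, 'b, 'k, 'l) rrb_action" where
  "ext_action E sH sG =
    (let H = rH (eH E); G = rG (eH E); \<phi> = rphi (eH E) in
     \<lparr>act_nu = \<lambda>b. \<lambda>k \<in> carrier (rH (eK E)). ret1 E (\<phi> (sG b) (inc1 E k)),
      act_mu = \<lambda>a. \<lambda>k \<in> carrier (rH (eK E)).
                 ret1 E (inv\<^bsub>H\<^esub> (sH a) \<otimes>\<^bsub>H\<^esub> inc1 E k \<otimes>\<^bsub>H\<^esub> sH a),
      act_sigma = \<lambda>b. \<lambda>l \<in> carrier (rG (eK E)).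
                 ret2 E (inv\<^bsub>G\<^esub> (sG b) \<otimes>\<^bsub>G\<^esub> inc2 E l \<otimes>\<^bsub>G\<^esub> sG b),
      act_f = \<lambda>l a. ret1 E (inv\<^bsub>H\<^esub> (sH a) \<otimes>\<^bsub>H\<^esub> \<phi> (inc2 E l) (sH a))\<rparr>)"

text \<open>The action defining the module \<open>\<K>\<^sub>\<psi>\<close>.\<close>

definition twist_action ::
    "('a \<Rightarrow> 'a) \<times> ('b \<Rightarrow> 'b) \<Rightarrow> ('a, 'b, 'k, 'l) rrb_action \<Rightarrow> ('a, 'b, 'k, 'l) rrb_action" where
  "twist_action \<psi> M =
     \<lparr>act_nu = \<lambda>b. act_nu M (snd \<psi> b),
      act_mu = \<lambda>a. act_mu M (fst \<psi> a),
      act_sigma = \<lambda>b. act_sigma M (snd \<psi> b),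
      act_f = \<lambda>l a. act_f M l (fst \<psi> a)\<rparr>"

text \<open>\<open>\<theta>\<close> is an isomorphism of \<open>\<A>\<close>-modules from \<open>\<K>\<close> with action \<open>M\<close> to \<open>\<K>\<close> with
  action \<open>M'\<close>.\<close>

definition rrb_module_iso ::
    "('a, 'b) rrb \<Rightarrow> ('k, 'l) rrb \<Rightarrow> ('a, 'b, 'k, 'l) rrb_action \<Rightarrow> ('a, 'b, 'k, 'l) rrb_action \<Rightarrow>
     ('k \<Rightarrow> 'k) \<times> ('l \<Rightarrow> 'l) \<Rightarrow> bool" where
  "rrb_module_iso A K M M' \<theta> \<longleftrightarrow>
     \<theta> \<in> rrb_auto K \<and>
     (\<forall>b \<in> carrier (rG A). \<forall>k \<in> carrier (rH K).
        fst \<theta> (act_nu M b k) = act_nu M' b (fst \<theta> k)) \<and>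
     (\<forall>a \<in> carrier (rH A). \<forall>k \<in> carrier (rH K).
        fst \<theta> (act_mu M a k) = act_mu M' a (fst \<theta> k)) \<and>
     (\<forall>b \<in> carrier (rG A). \<forall>l \<in> carrier (rG K).
        snd \<theta> (act_sigma M b l) = act_sigma M' b (snd \<theta> l)) \<and>
     (\<forall>l \<in> carrier (rG K). \<forall>a \<in> carrier (rH A).
        fst \<theta> (act_f M l a) = act_f M' (snd \<theta> l) a)"

type_synonym ('a, 'b, 'k, 'l) rrb_cochain =
  "('a \<times> 'a \<Rightarrow> 'k) \<times> ('b \<times> 'b \<Rightarrow> 'l) \<times> ('a \<times> 'b \<Rightarrow> 'k) \<times> ('a \<Rightarrow> 'l)"

text \<open>The components of a cochain are extensional, so that cochains are determined by their
  values on the carriers.\<close>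

definition rrb_C2 :: "('a, 'b) rrb \<Rightarrow> ('k, 'l) rrb \<Rightarrow> ('a, 'b, 'k, 'l) rrb_cochain monoid" where
  "rrb_C2 A K =
    (let cA = carrier (rH A); cB = carrier (rG A); cK = carrier (rH K); cL = carrier (rG K) in
     \<lparr>carrier = {(\<tau>\<^sub>1, \<tau>\<^sub>2, \<rho>, \<chi>).
        \<tau>\<^sub>1 \<in> (cA \<times> cA) \<rightarrow>\<^sub>E cK \<and> \<tau>\<^sub>2 \<in> (cB \<times> cB) \<rightarrow>\<^sub>E cL \<and>
        \<rho> \<in> (cA \<times> cB) \<rightarrow>\<^sub>E cK \<and> \<chi> \<in> cA \<rightarrow>\<^sub>E cL \<and>
        (\<forall>a \<in> cA. \<tau>\<^sub>1 (\<one>\<^bsub>rH A\<^esub>, a) = \<one>\<^bsub>rH K\<^esub> \<and> \<tau>\<^sub>1 (a, \<one>\<^bsub>rH A\<^esub>) = \<one>\<^bsub>rH K\<^esub>) \<and>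
        (\<forall>b \<in> cB. \<tau>\<^sub>2 (\<one>\<^bsub>rG A\<^esub>, b) = \<one>\<^bsub>rG K\<^esub> \<and> \<tau>\<^sub>2 (b, \<one>\<^bsub>rG A\<^esub>) = \<one>\<^bsub>rG K\<^esub>) \<and>
        (\<forall>b \<in> cB. \<rho> (\<one>\<^bsub>rH A\<^esub>, b) = \<one>\<^bsub>rH K\<^esub>) \<and>
        (\<forall>a \<in> cA. \<rho> (a, \<one>\<^bsub>rG A\<^esub>) = \<one>\<^bsub>rH K\<^esub>) \<and>
        \<chi> \<one>\<^bsub>rH A\<^esub> = \<one>\<^bsub>rG K\<^esub>},
      mult = \<lambda>(\<tau>\<^sub>1, \<tau>\<^sub>2, \<rho>, \<chi>) (\<tau>\<^sub>1', \<tau>\<^sub>2', \<rho>', \<chi>').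
        (\<lambda>x \<in> cA \<times> cA. \<tau>\<^sub>1 x \<otimes>\<^bsub>rH K\<^esub> \<tau>\<^sub>1' x, \<lambda>x \<in> cB \<times> cB. \<tau>\<^sub>2 x \<otimes>\<^bsub>rG K\<^esub> \<tau>\<^sub>2' x,
         \<lambda>x \<in> cA \<times> cB. \<rho> x \<otimes>\<^bsub>rH K\<^esub> \<rho>' x, \<lambda>x \<in> cA. \<chi> x \<otimes>\<^bsub>rG K\<^esub> \<chi>' x),
      one = (\<lambda>x \<in> cA \<times> cA. \<one>\<^bsub>rH K\<^esub>, \<lambda>x \<in> cB \<times> cB. \<one>\<^bsub>rG K\<^esub>,
             \<lambda>x \<in> cA \<times> cB. \<one>\<^bsub>rH K\<^esub>, \<lambda>x \<in> cA. \<one>\<^bsub>rG K\<^esub>)\<rparr>)"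

definition circ_T :: "('a, 'b) rrb \<Rightarrow> 'a \<Rightarrow> 'a \<Rightarrow> 'a" where
  "circ_T A a\<^sub>1 a\<^sub>2 = a\<^sub>1 \<otimes>\<^bsub>rH A\<^esub> rphi A (rR A a\<^sub>1) a\<^sub>2"

definition nu_inv :: "('k, 'l) rrb \<Rightarrow> ('a, 'b, 'k, 'l) rrb_action \<Rightarrow> 'b \<Rightarrow> 'k \<Rightarrow> 'k" where
  "nu_inv K M b = inv_into (carrier (rH K)) (act_nu M b)"

definition rrb_Z2 ::
    "('a, 'b) rrb \<Rightarrow> ('k, 'l) rrb \<Rightarrow> ('a, 'b, 'k, 'l) rrb_action \<Rightarrow>
     ('a, 'b, 'k, 'l) rrb_cochain set" where
  "rrb_Z2 A K M =
    (let cA = carrier (rH A); cB = carrier (rG A); \<beta> = rphi A; T = rR A; S = rR K;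
         \<nu> = act_nu M; \<mu> = act_mu M; \<sigma> = act_sigma M; f = act_f M in
     {(\<tau>\<^sub>1, \<tau>\<^sub>2, \<rho>, \<chi>). (\<tau>\<^sub>1, \<tau>\<^sub>2, \<rho>, \<chi>) \<in> carrier (rrb_C2 A K) \<and>
       (\<forall>a\<^sub>1 \<in> cA. \<forall>a\<^sub>2 \<in> cA. \<forall>a\<^sub>3 \<in> cA.
          \<tau>\<^sub>1 (a\<^sub>2, a\<^sub>3) \<otimes>\<^bsub>rH K\<^esub> \<tau>\<^sub>1 (a\<^sub>1, a\<^sub>2 \<otimes>\<^bsub>rH A\<^esub> a\<^sub>3)
          = \<tau>\<^sub>1 (a\<^sub>1 \<otimes>\<^bsub>rH A\<^esub> a\<^sub>2, a\<^sub>3) \<otimes>\<^bsub>rH K\<^esub> \<mu> a\<^sub>3 (\<tau>\<^sub>1 (a\<^sub>1, a\<^sub>2))) \<and>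
       (\<forall>b\<^sub>1 \<in> cB. \<forall>b\<^sub>2 \<in> cB. \<forall>b\<^sub>3 \<in> cB.
          \<tau>\<^sub>2 (b\<^sub>2, b\<^sub>3) \<otimes>\<^bsub>rG K\<^esub> \<tau>\<^sub>2 (b\<^sub>1, b\<^sub>2 \<otimes>\<^bsub>rG A\<^esub> b\<^sub>3)
          = \<tau>\<^sub>2 (b\<^sub>1 \<otimes>\<^bsub>rG A\<^esub> b\<^sub>2, b\<^sub>3) \<otimes>\<^bsub>rG K\<^esub> \<sigma> b\<^sub>3 (\<tau>\<^sub>2 (b\<^sub>1, b\<^sub>2))) \<and>
       (\<forall>a\<^sub>1 \<in> cA. \<forall>b\<^sub>1 \<in> cB. \<forall>b\<^sub>2 \<in> cB.
          \<rho> (\<beta> b\<^sub>2 a\<^sub>1, b\<^sub>1) \<otimes>\<^bsub>rH K\<^esub> \<nu> b\<^sub>1 (\<rho> (a\<^sub>1, b\<^sub>2))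
          = \<rho> (a\<^sub>1, b\<^sub>1 \<otimes>\<^bsub>rG A\<^esub> b\<^sub>2) \<otimes>\<^bsub>rH K\<^esub> \<nu> (b\<^sub>1 \<otimes>\<^bsub>rG A\<^esub> b\<^sub>2) (f (\<tau>\<^sub>2 (b\<^sub>1, b\<^sub>2)) a\<^sub>1)) \<and>
       (\<forall>a\<^sub>1 \<in> cA. \<forall>a\<^sub>2 \<in> cA. \<forall>b\<^sub>1 \<in> cB.
          \<rho> (a\<^sub>1 \<otimes>\<^bsub>rH A\<^esub> a\<^sub>2, b\<^sub>1) \<otimes>\<^bsub>rH K\<^esub> \<nu> b\<^sub>1 (\<tau>\<^sub>1 (a\<^sub>1, a\<^sub>2))
          = \<mu> (\<beta> b\<^sub>1 a\<^sub>2) (\<rho> (a\<^sub>1, b\<^sub>1)) \<otimes>\<^bsub>rH K\<^esub> \<rho> (a\<^sub>2, b\<^sub>1) \<otimes>\<^bsub>rH K\<^esub> \<tau>\<^sub>1 (\<beta> b\<^sub>1 a\<^sub>1, \<beta> b\<^sub>1 a\<^sub>2)) \<and>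
       (\<forall>a\<^sub>1 \<in> cA. \<forall>a\<^sub>2 \<in> cA.
          \<tau>\<^sub>2 (T a\<^sub>1, T a\<^sub>2) \<otimes>\<^bsub>rG K\<^esub> \<chi> a\<^sub>2 \<otimes>\<^bsub>rG K\<^esub> inv\<^bsub>rG K\<^esub> (\<chi> (circ_T A a\<^sub>1 a\<^sub>2))
            \<otimes>\<^bsub>rG K\<^esub> \<sigma> (T a\<^sub>2) (\<chi> a\<^sub>1)
          = S (nu_inv K M (T (circ_T A a\<^sub>1 a\<^sub>2))
                (\<rho> (a\<^sub>2, T a\<^sub>1) \<otimes>\<^bsub>rH K\<^esub> \<tau>\<^sub>1 (a\<^sub>1, \<beta> (T a\<^sub>1) a\<^sub>2) \<otimes>\<^bsub>rH K\<^esub> \<nu> (T a\<^sub>1) (f (\<chi> a\<^sub>1) a\<^sub>2))))})"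

definition rrb_B2 ::
    "('a, 'b) rrb \<Rightarrow> ('k, 'l) rrb \<Rightarrow> ('a, 'b, 'k, 'l) rrb_action \<Rightarrow>
     ('a, 'b, 'k, 'l) rrb_cochain set" where
  "rrb_B2 A K M =
    (let cA = carrier (rH A); cB = carrier (rG A); \<beta> = rphi A; T = rR A; S = rR K;
         \<nu> = act_nu M; \<mu> = act_mu M; \<sigma> = act_sigma M; f = act_f M in
     {(\<tau>\<^sub>1, \<tau>\<^sub>2, \<rho>, \<chi>). (\<tau>\<^sub>1, \<tau>\<^sub>2, \<rho>, \<chi>) \<in> rrb_Z2 A K M \<and>
       (\<exists>\<kappa>\<^sub>1 \<in> cA \<rightarrow> carrier (rH K). \<exists>\<kappa>\<^sub>2 \<in> cB \<rightarrow> carrier (rG K).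
          \<kappa>\<^sub>1 \<one>\<^bsub>rH A\<^esub> = \<one>\<^bsub>rH K\<^esub> \<and> \<kappa>\<^sub>2 \<one>\<^bsub>rG A\<^esub> = \<one>\<^bsub>rG K\<^esub> \<and>
          (\<forall>a\<^sub>1 \<in> cA. \<forall>a\<^sub>2 \<in> cA.
             \<tau>\<^sub>1 (a\<^sub>1, a\<^sub>2)
             = inv\<^bsub>rH K\<^esub> (\<kappa>\<^sub>1 (a\<^sub>1 \<otimes>\<^bsub>rH A\<^esub> a\<^sub>2)) \<otimes>\<^bsub>rH K\<^esub> \<kappa>\<^sub>1 a\<^sub>2 \<otimes>\<^bsub>rH K\<^esub> \<mu> a\<^sub>2 (\<kappa>\<^sub>1 a\<^sub>1)) \<and>
          (\<forall>b\<^sub>1 \<in> cB. \<forall>b\<^sub>2 \<in> cB.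
             \<tau>\<^sub>2 (b\<^sub>1, b\<^sub>2)
             = inv\<^bsub>rG K\<^esub> (\<kappa>\<^sub>2 (b\<^sub>1 \<otimes>\<^bsub>rG A\<^esub> b\<^sub>2)) \<otimes>\<^bsub>rG K\<^esub> \<kappa>\<^sub>2 b\<^sub>2 \<otimes>\<^bsub>rG K\<^esub> \<sigma> b\<^sub>2 (\<kappa>\<^sub>2 b\<^sub>1)) \<and>
          (\<forall>a \<in> cA. \<forall>b \<in> cB.
             \<rho> (a, b)
             = \<nu> b (f (\<kappa>\<^sub>2 b) a \<otimes>\<^bsub>rH K\<^esub> \<kappa>\<^sub>1 a) \<otimes>\<^bsub>rH K\<^esub> inv\<^bsub>rH K\<^esub> (\<kappa>\<^sub>1 (\<beta> b a))) \<and>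
          (\<forall>a \<in> cA.
             \<chi> a = S (nu_inv K M (T a) (\<kappa>\<^sub>1 a)) \<otimes>\<^bsub>rG K\<^esub> inv\<^bsub>rG K\<^esub> (\<kappa>\<^sub>2 (T a))))})"

definition rrb_Z2_group ::
    "('a, 'b) rrb \<Rightarrow> ('k, 'l) rrb \<Rightarrow> ('a, 'b, 'k, 'l) rrb_action \<Rightarrow>
     ('a, 'b, 'k, 'l) rrb_cochain monoid" where
  "rrb_Z2_group A K M = (rrb_C2 A K)\<lparr>carrier := rrb_Z2 A K M\<rparr>"

definition rrb_H2 ::
    "('a, 'b) rrb \<Rightarrow> ('k, 'l) rrb \<Rightarrow> ('a, 'b, 'k, 'l) rrb_action \<Rightarrow>
     ('a, 'b, 'k, 'l) rrb_cochain set monoid" where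
  "rrb_H2 A K M = rrb_Z2_group A K M Mod rrb_B2 A K M"

definition rrb_class ::
    "('a, 'b) rrb \<Rightarrow> ('k, 'l) rrb \<Rightarrow> ('a, 'b, 'k, 'l) rrb_action \<Rightarrow>
     ('a, 'b, 'k, 'l) rrb_cochain \<Rightarrow> ('a, 'b, 'k, 'l) rrb_cochain set" where
  "rrb_class A K M c = rrb_B2 A K M #>\<^bsub>rrb_Z2_group A K M\<^esub> c"

definition ext_cocycle ::
    "('k, 'l, 'h, 'g, 'a, 'b) rrb_ext \<Rightarrow> ('a \<Rightarrow> 'h) \<Rightarrow> ('b \<Rightarrow> 'g) \<Rightarrow>
     ('a, 'b, 'k, 'l) rrb_cochain" where
  "ext_cocycle E sH sG =
    (let A = rH (eA E); B = rG (eA E); \<beta> = rphi (eA E); T = rR (eA E);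
         H = rH (eH E); G = rG (eH E); \<phi> = rphi (eH E); R = rR (eH E) in
     (\<lambda>(a\<^sub>1, a\<^sub>2) \<in> carrier A \<times> carrier A.
        ret1 E (inv\<^bsub>H\<^esub> (sH (a\<^sub>1 \<otimes>\<^bsub>A\<^esub> a\<^sub>2)) \<otimes>\<^bsub>H\<^esub> sH a\<^sub>1 \<otimes>\<^bsub>H\<^esub> sH a\<^sub>2),
      \<lambda>(b\<^sub>1, b\<^sub>2) \<in> carrier B \<times> carrier B.
        ret2 E (inv\<^bsub>G\<^esub> (sG (b\<^sub>1 \<otimes>\<^bsub>B\<^esub> b\<^sub>2)) \<otimes>\<^bsub>G\<^esub> sG b\<^sub>1 \<otimes>\<^bsub>G\<^esub> sG b\<^sub>2),
      \<lambda>(a, b) \<in> carrier A \<times> carrier B.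
        ret1 E (inv\<^bsub>H\<^esub> (sH (\<beta> b a)) \<otimes>\<^bsub>H\<^esub> \<phi> (sG b) (sH a)),
      \<lambda>a \<in> carrier A. ret2 E (inv\<^bsub>G\<^esub> (sG (T a)) \<otimes>\<^bsub>G\<^esub> R (sH a))))"

definition ext_class ::
    "('k, 'l, 'h, 'g, 'a, 'b) rrb_ext \<Rightarrow> ('a \<Rightarrow> 'h) \<Rightarrow> ('b \<Rightarrow> 'g) \<Rightarrow>
     ('a, 'b, 'k, 'l) rrb_cochain set" where
  "ext_class E sH sG = rrb_class (eA E) (eK E) (ext_action E sH sG) (ext_cocycle E sH sG)"

definition pullback_cochain ::
    "('a, 'b) rrb \<Rightarrow> ('a \<Rightarrow> 'a) \<times> ('b \<Rightarrow> 'b) \<Rightarrow>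
     ('a, 'b, 'k, 'l) rrb_cochain \<Rightarrow> ('a, 'b, 'k, 'l) rrb_cochain" where
  "pullback_cochain A = (\<lambda>(\<psi>\<^sub>1, \<psi>\<^sub>2) (\<tau>\<^sub>1, \<tau>\<^sub>2, \<rho>, \<chi>).
     (\<lambda>(a\<^sub>1, a\<^sub>2) \<in> carrier (rH A) \<times> carrier (rH A). \<tau>\<^sub>1 (\<psi>\<^sub>1 a\<^sub>1, \<psi>\<^sub>1 a\<^sub>2),
      \<lambda>(b\<^sub>1, b\<^sub>2) \<in> carrier (rG A) \<times> carrier (rG A). \<tau>\<^sub>2 (\<psi>\<^sub>2 b\<^sub>1, \<psi>\<^sub>2 b\<^sub>2),
      \<lambda>(a, b) \<in> carrier (rH A) \<times> carrier (rG A). \<rho> (\<psi>\<^sub>1 a, \<psi>\<^sub>2 b),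
      \<lambda>a \<in> carrier (rH A). \<chi> (\<psi>\<^sub>1 a)))"

definition pushforward_cochain ::
    "('a, 'b) rrb \<Rightarrow> ('k \<Rightarrow> 'k) \<times> ('l \<Rightarrow> 'l) \<Rightarrow>
     ('a, 'b, 'k, 'l) rrb_cochain \<Rightarrow> ('a, 'b, 'k, 'l) rrb_cochain" where
  "pushforward_cochain A = (\<lambda>(\<theta>\<^sub>1, \<theta>\<^sub>2) (\<tau>\<^sub>1, \<tau>\<^sub>2, \<rho>, \<chi>).
     (compose (carrier (rH A) \<times> carrier (rH A)) \<theta>\<^sub>1 \<tau>\<^sub>1,
      compose (carrier (rG A) \<times> carrier (rG A)) \<theta>\<^sub>2 \<tau>\<^sub>2,
      compose (carrier (rH A) \<times> carrier (rG A)) \<theta>\<^sub>1 \<rho>,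
      compose (carrier (rH A)) \<theta>\<^sub>2 \<chi>))"

text \<open>Maps \<open>H\<^sup>2(\<A>, \<K>) \<rightarrow> H\<^sup>2(\<A>, \<K>\<^sub>\<psi>)\<close>. The value on a class \<open>X\<close> is the common class of the images
  of all representatives of \<open>X\<close>; for \<open>theta_star\<close> it is a single class when \<open>\<theta>\<close> is a module
  isomorphism \<open>\<K> \<rightarrow> \<K>\<^sub>\<psi>\<close>.\<close>

definition psi_star ::
    "('a, 'b) rrb \<Rightarrow> ('k, 'l) rrb \<Rightarrow> ('a, 'b, 'k, 'l) rrb_action \<Rightarrow>
     ('a \<Rightarrow> 'a) \<times> ('b \<Rightarrow> 'b) \<Rightarrow>
     ('a, 'b, 'k, 'l) rrb_cochain set \<Rightarrow> ('a, 'b, 'k, 'l) rrb_cochain set" where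
  "psi_star A K M \<psi> = (\<lambda>X \<in> carrier (rrb_H2 A K M).
     the_elem ((\<lambda>c. rrb_class A K (twist_action \<psi> M) (pullback_cochain A \<psi> c)) ` X))"

definition theta_star ::
    "('a, 'b) rrb \<Rightarrow> ('k, 'l) rrb \<Rightarrow> ('a, 'b, 'k, 'l) rrb_action \<Rightarrow>
     ('a \<Rightarrow> 'a) \<times> ('b \<Rightarrow> 'b) \<Rightarrow> ('k \<Rightarrow> 'k) \<times> ('l \<Rightarrow> 'l) \<Rightarrow>
     ('a, 'b, 'k, 'l) rrb_cochain set \<Rightarrow> ('a, 'b, 'k, 'l) rrb_cochain set" where
  "theta_star A K M \<psi> \<theta> = (\<lambda>X \<in> carrier (rrb_H2 A K M).
     the_elem ((\<lambda>c. rrb_class A K (twist_action \<psi> M) (pushforward_cochain A \<theta> c)) ` X))"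

definition rrb_auto_normalizing ::
    "('k, 'l, 'h, 'g, 'a, 'b) rrb_ext \<Rightarrow> (('h \<Rightarrow> 'h) \<times> ('g \<Rightarrow> 'g)) set" where
  "rrb_auto_normalizing E = {(\<gamma>\<^sub>1, \<gamma>\<^sub>2) \<in> rrb_auto (eH E).
     \<gamma>\<^sub>1 ` (inc1 E ` carrier (rH (eK E))) = inc1 E ` carrier (rH (eK E)) \<and>
     \<gamma>\<^sub>2 ` (inc2 E ` carrier (rG (eK E))) = inc2 E ` carrier (rG (eK E))}"

definition auto_on_K ::
    "('k, 'l, 'h, 'g, 'a, 'b) rrb_ext \<Rightarrow> ('h \<Rightarrow> 'h) \<times> ('g \<Rightarrow> 'g) \<Rightarrow>
     ('k \<Rightarrow> 'k) \<times> ('l \<Rightarrow> 'l)" where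
  "auto_on_K E \<gamma> =
     (\<lambda>k \<in> carrier (rH (eK E)). ret1 E (fst \<gamma> (inc1 E k)),
      \<lambda>l \<in> carrier (rG (eK E)). ret2 E (snd \<gamma> (inc2 E l)))"

definition auto_on_A ::
    "('k, 'l, 'h, 'g, 'a, 'b) rrb_ext \<Rightarrow> ('a \<Rightarrow> 'h) \<Rightarrow> ('b \<Rightarrow> 'g) \<Rightarrow>
     ('h \<Rightarrow> 'h) \<times> ('g \<Rightarrow> 'g) \<Rightarrow> ('a \<Rightarrow> 'a) \<times> ('b \<Rightarrow> 'b)" where
  "auto_on_A E sH sG \<gamma> =
     (\<lambda>a \<in> carrier (rH (eA E)). proj1 E (fst \<gamma> (sH a)),
      \<lambda>b \<in> carrier (rG (eA E)). proj2 E (snd \<gamma> (sG b)))"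

definition inducible ::
    "('k, 'l, 'h, 'g, 'a, 'b) rrb_ext \<Rightarrow> ('a \<Rightarrow> 'h) \<Rightarrow> ('b \<Rightarrow> 'g) \<Rightarrow>
     ('a \<Rightarrow> 'a) \<times> ('b \<Rightarrow> 'b) \<Rightarrow> ('k \<Rightarrow> 'k) \<times> ('l \<Rightarrow> 'l) \<Rightarrow> bool" where
  "inducible E sH sG \<psi> \<theta> \<longleftrightarrow>
     (\<exists>\<gamma> \<in> rrb_auto_normalizing E. \<psi> = auto_on_A E sH sG \<gamma> \<and> \<theta> = auto_on_K E \<gamma>)"

end

theory Submission
  imports Defs
begin

text \<open>Every element of the middle term of the extension has a unique normal form \<open>s(a) k\<close>, and in
  normal forms the products, \<open>\<phi>\<close> and \<open>R\<close> are given by the action \<open>(\<nu>, \<mu>, \<sigma>, f)\<close> and the cocycle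
  \<open>(\<tau>\<^sub>1, \<tau>\<^sub>2, \<rho>, \<chi>)\<close>. An automorphism \<open>\<gamma>\<close> inducing \<open>(\<psi>, \<theta>)\<close> must send \<open>s(a) k\<close> to
  \<open>s(\<psi>(a)) \<kappa>(a) \<theta>(k)\<close> for some \<open>\<kappa>\<close>, componentwise in \<open>H\<close> and \<open>G\<close>. Comparing normal forms, such a map
  is a homomorphism of relative Rota--Baxter groups exactly if \<open>\<theta>\<close> is a module isomorphism
  \<open>\<K> \<rightarrow> \<K>\<^sub>\<psi>\<close> and \<open>\<kappa>\<close> exhibits \<open>\<theta>(\<tau>\<^sub>1, \<tau>\<^sub>2, \<rho>, \<chi>)\<close> over \<open>(\<tau>\<^sub>1, \<tau>\<^sub>2, \<rho>, \<chi>) \<circ> \<psi>\<close> as a coboundary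
  with coefficients in \<open>\<K>\<^sub>\<psi>\<close>.\<close>

section \<open>Group extensions with abelian kernel\<close>

text \<open>The components H and G are two separate group extensions, linked only by \<phi> and R,
  so everything that concerns multiplication is proved once for a group extension and used twice.
  The delicate structure map is R. The Rota--Baxter identity multiplies through \<phi>, so R(s_H(a)
  k) is R(s_H(a)) R(k') with k' the preimage of k under \<nu> at T(a). This is where the inverse of
  \<nu> in condition (v) and in the coboundary formula for \<chi> comes from. Condition (2) compares
  cosets. Turning it into the existence of a pair of cochains requires cocycles and coboundaries to
  be subgroups of one ambient group and the starred maps to be constant on cosets. Both rest on
  linearity: K and L are abelian and every action map is a homomorphism in its K- or L-argument, so
  all formulas are multiplicative in the cochain. The normalization \<kappa>(1) = 1 expresses that
  the lifted map restricts to \<theta> on the kernel.\<close>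

lemma (in comm_group) hom_multI:
  assumes "group C" "f \<in> hom C G" "g \<in> hom C G"
  shows "(\<lambda>c. f c \<otimes> g c) \<in> hom C G"
  using assms by (auto simp: hom_def Pi_iff m_ac)

lemma (in comm_group) hom_invI:
  assumes "group C" "f \<in> hom C G"
  shows "(\<lambda>c. inv (f c)) \<in> hom C G"
  using assms by (auto simp: hom_def Pi_iff inv_mult)

text \<open>Clears the inverses from the coboundary equations, whose inverse-free form is what a
  comparison of normal forms produces.\<close>

lemma (in comm_group) div_eq_div_iff:
  assumes "x \<in> carrier G" "y \<in> carrier G" "z \<in> carrier G" "u \<in> carrier G"
  shows "x \<otimes> inv y = u \<otimes> inv z \<longleftrightarrow> z \<otimes> x = y \<otimes> u"
proof -
  have "x \<otimes> inv y = u \<otimes> inv z \<longleftrightarrow> x = u \<otimes> inv z \<otimes> y"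
    using assms by (metis inv_solve_right inv_closed m_closed)
  also have "u \<otimes> inv z \<otimes> y = y \<otimes> u \<otimes> inv z"
    using assms by (simp add: m_ac)
  also have "x = y \<otimes> u \<otimes> inv z \<longleftrightarrow> z \<otimes> x = y \<otimes> u"
    using assms by (metis inv_solve_right m_closed m_comm)
  finally show ?thesis .
qed

text \<open>Serves the cocycle conditions: \<open>J\<close> is the set of argument tuples of one
  condition, and \<open>f j\<close>, \<open>g j\<close> are its two sides as functions of the
  cochain.\<close>

lemma (in group) subgroup_equalizers:
  assumes "group D"
    and "\<And>j. j \<in> J \<Longrightarrow> f j \<in> hom G D" and "\<And>j. j \<in> J \<Longrightarrow> g j \<in> hom G D"
  shows "subgroup {x \<in> carrier G. \<forall>j \<in> J. f j x = g j x} G"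
proof -
  have f: "group_hom G D (f j)" and g: "group_hom G D (g j)" if "j \<in> J" for j
    using assms that is_group by (auto simp: group_hom_def group_hom_axioms_def)
  show ?thesis
    by unfold_locales
      (auto simp: group_hom.hom_mult[OF f] group_hom.hom_mult[OF g] group_hom.hom_one[OF f]
        group_hom.hom_one[OF g] group_hom.hom_inv[OF f] group_hom.hom_inv[OF g])
qed

text \<open>Applying \<open>g\<close> to both sides gives \<open>t x\<close> twice, and
  \<open>g\<close> is injective. It carries the compatibility of \<theta> with \<nu> over to the
  inverse of \<nu>.\<close>

lemma bij_betw_conj_inv_into:
  assumes f: "bij_betw f S S" and g: "bij_betw g S S" and t: "t \<in> S \<rightarrow> S"
    and eq: "\<And>x. x \<in> S \<Longrightarrow> t (f x) = g (t x)" and x: "x \<in> S"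
  shows "t (inv_into S f x) = inv_into S g (t x)"
proof -
  have "inv_into S f x \<in> S" and "f (inv_into S f x) = x"
    using f x by (auto simp: bij_betw_def inv_into_into f_inv_into_f)
  with eq t g show ?thesis by (metis bij_betw_inv_into_left funcset_mem)
qed

lemma autoD:
  assumes "f \<in> auto G"
  shows "f \<in> hom G G" "bij_betw f (carrier G) (carrier G)" "f \<in> extensional (carrier G)"
  using assms by (auto simp: auto_def Bij_def)

text \<open>One group extension with a normalized section, without any Rota--Baxter structure. It is
  instantiated for K, H, A and again for L, G, B.\<close>

locale abelian_extension =
  K: comm_group K + incl: group_hom K H i + proj: group_hom H A p
  for K (structure) and H (structure) and A (structure) and i p +
  fixes s :: "'c \<Rightarrow> 'b"
  assumes inj_incl: "inj_on i (carrier K)"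
    and image_incl: "i ` carrier K = kernel H A p"
    and section_closed [simp]: "a \<in> carrier A \<Longrightarrow> s a \<in> carrier H"
    and proj_section [simp]: "a \<in> carrier A \<Longrightarrow> p (s a) = a"
    and section_one [simp]: "s \<one>\<^bsub>A\<^esub> = \<one>\<^bsub>H\<^esub>"
begin

definition ret :: "'b \<Rightarrow> 'a" where
  "ret = inv_into (carrier K) i"

definition elt :: "'c \<Rightarrow> 'a \<Rightarrow> 'b" where
  "elt a k = s a \<otimes>\<^bsub>H\<^esub> i k"

text \<open>The kernel coordinate of the normal form: dividing by the section value over
  \<open>p x\<close> leaves an element of the kernel. The values of the cocycle, and later those of
  \<kappa>, are all of the form \<open>part x\<close>.\<close>

definition part :: "'b \<Rightarrow> 'a" where
  "part x = ret (inv\<^bsub>H\<^esub> s (p x) \<otimes>\<^bsub>H\<^esub> x)"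

text \<open>The factor that appears when \<open>i k\<close> is moved to the right past
  \<open>s a\<close>; it becomes \<mu> for H and \<sigma> for G, just as \<open>coc\<close> becomes
  the first and the second component of the cocycle.\<close>

definition conjugate :: "'c \<Rightarrow> 'a \<Rightarrow> 'a" where
  "conjugate a k = ret (inv\<^bsub>H\<^esub> s a \<otimes>\<^bsub>H\<^esub> i k \<otimes>\<^bsub>H\<^esub> s a)"

definition coc :: "'c \<Rightarrow> 'c \<Rightarrow> 'a" where
  "coc a b = ret (inv\<^bsub>H\<^esub> s (a \<otimes>\<^bsub>A\<^esub> b) \<otimes>\<^bsub>H\<^esub> s a \<otimes>\<^bsub>H\<^esub> s b)"

lemma proj_incl [simp]: "k \<in> carrier K \<Longrightarrow> p (i k) = \<one>\<^bsub>A\<^esub>"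
  using image_incl by (auto simp: kernel_def)

lemma ret_incl [simp]: "k \<in> carrier K \<Longrightarrow> ret (i k) = k"
  by (simp add: ret_def inj_incl)

lemma
  assumes "x \<in> carrier H" "p x = \<one>\<^bsub>A\<^esub>"
  shows incl_ret: "i (ret x) = x" and ret_closed: "ret x \<in> carrier K"
proof -
  have "x \<in> i ` carrier K" using assms by (simp add: image_incl kernel_def)
  then show "i (ret x) = x" "ret x \<in> carrier K"
    by (simp_all add: ret_def f_inv_into_f inv_into_into)
qed

lemma elt_closed [simp]: "\<lbrakk>a \<in> carrier A; k \<in> carrier K\<rbrakk> \<Longrightarrow> elt a k \<in> carrier H"
  by (simp add: elt_def)

lemma proj_elt [simp]: "\<lbrakk>a \<in> carrier A; k \<in> carrier K\<rbrakk> \<Longrightarrow> p (elt a k) = a"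
  by (simp add: elt_def)

lemma elt_one [simp]: "a \<in> carrier A \<Longrightarrow> elt a \<one>\<^bsub>K\<^esub> = s a"
  by (simp add: elt_def)

lemma one_elt [simp]: "k \<in> carrier K \<Longrightarrow> elt \<one>\<^bsub>A\<^esub> k = i k"
  by (simp add: elt_def)

lemma inv_section_mult_elt [simp]:
  "\<lbrakk>a \<in> carrier A; k \<in> carrier K\<rbrakk> \<Longrightarrow> inv\<^bsub>H\<^esub> s a \<otimes>\<^bsub>H\<^esub> elt a k = i k"
  by (simp add: elt_def flip: incl.H.m_assoc)

lemma part_elt [simp]: "\<lbrakk>a \<in> carrier A; k \<in> carrier K\<rbrakk> \<Longrightarrow> part (elt a k) = k"
  by (simp add: part_def)

lemma elt_eq_iff [simp]:
  assumes "a \<in> carrier A" "k \<in> carrier K" "a' \<in> carrier A" "k' \<in> carrier K"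
  shows "elt a k = elt a' k' \<longleftrightarrow> a = a' \<and> k = k'"
  using assms by (metis part_elt proj_elt)

lemma
  assumes "x \<in> carrier H"
  shows part_closed [simp]: "part x \<in> carrier K"
    and elt_proj_part [simp]: "elt (p x) (part x) = x"
proof -
  have *: "inv\<^bsub>H\<^esub> s (p x) \<otimes>\<^bsub>H\<^esub> x \<in> carrier H" "p (inv\<^bsub>H\<^esub> s (p x) \<otimes>\<^bsub>H\<^esub> x) = \<one>\<^bsub>A\<^esub>"
    using assms by simp_all
  show "part x \<in> carrier K" using * by (simp add: part_def ret_closed)
  show "elt (p x) (part x) = x"
    unfolding elt_def part_def incl_ret[OF *] using assms by (simp flip: incl.H.m_assoc)
qed

lemma elt_cases:
  assumes "x \<in> carrier H"
  obtains a k where "a \<in> carrier A" "k \<in> carrier K" "x = elt a k"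
  using assms elt_proj_part part_closed proj.hom_closed by metis

lemma part_one [simp]: "part \<one>\<^bsub>H\<^esub> = \<one>\<^bsub>K\<^esub>"
  using part_elt[of "\<one>\<^bsub>A\<^esub>" "\<one>\<^bsub>K\<^esub>"] by (simp del: part_elt)

lemma ret_inv_section_mult:
  "\<lbrakk>x \<in> carrier H; p x = a\<rbrakk> \<Longrightarrow> ret (inv\<^bsub>H\<^esub> s a \<otimes>\<^bsub>H\<^esub> x) = part x"
  by (auto simp: part_def)

lemma conjugate_closed [simp]: "\<lbrakk>a \<in> carrier A; k \<in> carrier K\<rbrakk> \<Longrightarrow> conjugate a k \<in> carrier K"
  by (simp add: conjugate_def ret_closed)

lemma incl_mult_section:
  assumes "a \<in> carrier A" "k \<in> carrier K"
  shows "i k \<otimes>\<^bsub>H\<^esub> s a = elt a (conjugate a k)"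
  using assms by (simp add: elt_def conjugate_def incl_ret flip: incl.H.m_assoc)

lemma coc_eq_part: "\<lbrakk>a \<in> carrier A; b \<in> carrier A\<rbrakk> \<Longrightarrow> coc a b = part (s a \<otimes>\<^bsub>H\<^esub> s b)"
  by (simp add: coc_def part_def incl.H.m_assoc)

lemma coc_closed [simp]: "\<lbrakk>a \<in> carrier A; b \<in> carrier A\<rbrakk> \<Longrightarrow> coc a b \<in> carrier K"
  by (simp add: coc_eq_part)

lemma section_mult:
  assumes "a \<in> carrier A" "b \<in> carrier A"
  shows "s a \<otimes>\<^bsub>H\<^esub> s b = elt (a \<otimes>\<^bsub>A\<^esub> b) (coc a b)"
  using assms elt_proj_part[of "s a \<otimes>\<^bsub>H\<^esub> s b"] by (simp add: coc_eq_part)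

lemma elt_mult_incl:
  assumes "a \<in> carrier A" "k \<in> carrier K" "k' \<in> carrier K"
  shows "elt a k \<otimes>\<^bsub>H\<^esub> i k' = elt a (k \<otimes>\<^bsub>K\<^esub> k')"
  using assms by (simp add: elt_def incl.H.m_assoc)

text \<open>Moving \<open>i k\<close> past \<open>s b\<close> costs a conjugation, and merging
  \<open>s a\<close> with \<open>s b\<close> costs a value of \<open>coc\<close>. The group
  identities below are read off from this law by comparing kernel coordinates.\<close>

lemma elt_mult:
  assumes "a \<in> carrier A" "k \<in> carrier K" "b \<in> carrier A" "l \<in> carrier K"
  shows "elt a k \<otimes>\<^bsub>H\<^esub> elt b l = elt (a \<otimes>\<^bsub>A\<^esub> b) (coc a b \<otimes>\<^bsub>K\<^esub> conjugate b k \<otimes>\<^bsub>K\<^esub> l)"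
proof -
  have "elt a k \<otimes>\<^bsub>H\<^esub> elt b l = s a \<otimes>\<^bsub>H\<^esub> (i k \<otimes>\<^bsub>H\<^esub> s b) \<otimes>\<^bsub>H\<^esub> i l"
    using assms by (simp add: elt_def incl.H.m_assoc)
  also have "\<dots> = (s a \<otimes>\<^bsub>H\<^esub> s b) \<otimes>\<^bsub>H\<^esub> i (conjugate b k) \<otimes>\<^bsub>H\<^esub> i l"
    using assms by (simp add: incl_mult_section) (simp add: elt_def incl.H.m_assoc)
  finally show ?thesis
    using assms by (simp add: section_mult elt_mult_incl)
qed

lemma coc_one [simp]:
  "a \<in> carrier A \<Longrightarrow> coc \<one>\<^bsub>A\<^esub> a = \<one>\<^bsub>K\<^esub>" "a \<in> carrier A \<Longrightarrow> coc a \<one>\<^bsub>A\<^esub> = \<one>\<^bsub>K\<^esub>"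
proof -
  have [simp]: "ret \<one>\<^bsub>H\<^esub> = \<one>\<^bsub>K\<^esub>" by (metis K.one_closed incl.hom_one ret_incl)
  show "a \<in> carrier A \<Longrightarrow> coc \<one>\<^bsub>A\<^esub> a = \<one>\<^bsub>K\<^esub>" "a \<in> carrier A \<Longrightarrow> coc a \<one>\<^bsub>A\<^esub> = \<one>\<^bsub>K\<^esub>"
    by (simp_all add: coc_def)
qed

lemma conjugate_mult:
  assumes a: "a \<in> carrier A" and k: "k \<in> carrier K" "l \<in> carrier K"
  shows "conjugate a (k \<otimes>\<^bsub>K\<^esub> l) = conjugate a k \<otimes>\<^bsub>K\<^esub> conjugate a l"
proof -
  have "i (k \<otimes>\<^bsub>K\<^esub> l) \<otimes>\<^bsub>H\<^esub> s a = i k \<otimes>\<^bsub>H\<^esub> elt a (conjugate a l)"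
    using assms by (simp add: incl_mult_section incl.H.m_assoc)
  \<comment> \<open>Written over the identity of \<open>A\<close>, the kernel element falls under
    \<open>elt_mult\<close>, and the value of \<open>coc\<close> that arises is trivial.\<close>
  also have "\<dots> = elt \<one>\<^bsub>A\<^esub> k \<otimes>\<^bsub>H\<^esub> elt a (conjugate a l)"
    using assms by simp
  also have "\<dots> = elt a (conjugate a k \<otimes>\<^bsub>K\<^esub> conjugate a l)"
    unfolding elt_mult[OF proj.H.one_closed k(1) a conjugate_closed[OF a k(2)]] using assms by simp
  finally show ?thesis
    using assms by (subst (asm) incl_mult_section) auto
qed

lemma conjugate_hom: "a \<in> carrier A \<Longrightarrow> conjugate a \<in> hom K K"
  by (simp add: hom_def conjugate_mult)

lemma conjugate_K_one [simp]: "a \<in> carrier A \<Longrightarrow> conjugate a \<one>\<^bsub>K\<^esub> = \<one>\<^bsub>K\<^esub>"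
  using hom_one[OF conjugate_hom] K.is_group by simp

text \<open>Associativity of \<open>s a\<close>, \<open>s b\<close>, \<open>s c\<close>. The rule
  \<open>elt_one\<close> is switched off so that section values stay in normal form and
  \<open>elt_mult\<close> applies to them.\<close>

lemma coc_cocycle:
  assumes "a \<in> carrier A" "b \<in> carrier A" "c \<in> carrier A"
  shows "coc b c \<otimes>\<^bsub>K\<^esub> coc a (b \<otimes>\<^bsub>A\<^esub> c) = coc (a \<otimes>\<^bsub>A\<^esub> b) c \<otimes>\<^bsub>K\<^esub> conjugate c (coc a b)"
proof -
  have "elt a \<one>\<^bsub>K\<^esub> \<otimes>\<^bsub>H\<^esub> elt b \<one>\<^bsub>K\<^esub> \<otimes>\<^bsub>H\<^esub> elt c \<one>\<^bsub>K\<^esub>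
      = elt a \<one>\<^bsub>K\<^esub> \<otimes>\<^bsub>H\<^esub> (elt b \<one>\<^bsub>K\<^esub> \<otimes>\<^bsub>H\<^esub> elt c \<one>\<^bsub>K\<^esub>)"
    using assms by (simp add: incl.H.m_assoc)
  then show ?thesis
    using assms by (simp add: elt_mult proj.H.m_assoc K.m_comm del: elt_one)
qed

section \<open>Automorphisms of the middle group in normal forms\<close>

definition extend :: "('c \<Rightarrow> 'c) \<Rightarrow> ('a \<Rightarrow> 'a) \<Rightarrow> ('c \<Rightarrow> 'a) \<Rightarrow> 'b \<Rightarrow> 'b" where
  "extend \<psi> \<theta> \<kappa> = (\<lambda>x \<in> carrier H. elt (\<psi> (p x)) (\<kappa> (p x) \<otimes>\<^bsub>K\<^esub> \<theta> (part x)))"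

lemma extend_elt:
  "\<lbrakk>a \<in> carrier A; k \<in> carrier K\<rbrakk> \<Longrightarrow> extend \<psi> \<theta> \<kappa> (elt a k) = elt (\<psi> a) (\<kappa> a \<otimes>\<^bsub>K\<^esub> \<theta> k)"
  by (simp add: extend_def)

text \<open>Multiplicativity splits along \<open>elt_mult\<close>: the hypothesis on
  \<open>conjugate\<close> handles a kernel element passing a section value, the one on
  \<open>coc\<close> a product of two section values. Bijectivity is that of \<psi> on the base
  followed by that of \<theta> on each fibre, since \<kappa> only translates a fibre.\<close>

lemma extend_auto:
  assumes \<psi>: "\<psi> \<in> auto A" and \<theta>: "\<theta> \<in> auto K" and \<kappa>: "\<kappa> \<in> carrier A \<rightarrow> carrier K"
    and conjugate: "\<And>a k. \<lbrakk>a \<in> carrier A; k \<in> carrier K\<rbrakk> \<Longrightarrow> \<theta> (conjugate a k) = conjugate (\<psi> a) (\<theta> k)"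
    and coc: "\<And>a b. \<lbrakk>a \<in> carrier A; b \<in> carrier A\<rbrakk> \<Longrightarrow>
      \<kappa> (a \<otimes>\<^bsub>A\<^esub> b) \<otimes>\<^bsub>K\<^esub> \<theta> (coc a b) = coc (\<psi> a) (\<psi> b) \<otimes>\<^bsub>K\<^esub> conjugate (\<psi> b) (\<kappa> a) \<otimes>\<^bsub>K\<^esub> \<kappa> b"
  shows "extend \<psi> \<theta> \<kappa> \<in> auto H"
proof -
  interpret \<psi>: group_hom A A \<psi> by unfold_locales (rule autoD[OF \<psi>])
  interpret \<theta>: group_hom K K \<theta> by unfold_locales (rule autoD[OF \<theta>])
  have \<kappa>_closed [simp]: "\<kappa> a \<in> carrier K" if "a \<in> carrier A" for a using \<kappa> that by auto
  have closed: "extend \<psi> \<theta> \<kappa> x \<in> carrier H" if "x \<in> carrier H" for x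
    using that by (simp add: extend_def)
  have mult: "extend \<psi> \<theta> \<kappa> (x \<otimes>\<^bsub>H\<^esub> y) = extend \<psi> \<theta> \<kappa> x \<otimes>\<^bsub>H\<^esub> extend \<psi> \<theta> \<kappa> y"
    if x: "x \<in> carrier H" and y: "y \<in> carrier H" for x y
  proof -
    define a k b l where "a = p x" and "k = part x" and "b = p y" and "l = part y"
    have xy: "x = elt a k" "y = elt b l" and [simp]: "a \<in> carrier A" "k \<in> carrier K" "b \<in> carrier A" "l \<in> carrier K"
      using x y by (simp_all add: a_def k_def b_def l_def)
    have "extend \<psi> \<theta> \<kappa> (x \<otimes>\<^bsub>H\<^esub> y) =
        elt (\<psi> a \<otimes>\<^bsub>A\<^esub> \<psi> b) (\<kappa> (a \<otimes>\<^bsub>A\<^esub> b) \<otimes>\<^bsub>K\<^esub> \<theta> (coc a b) \<otimes>\<^bsub>K\<^esub> conjugate (\<psi> b) (\<theta> k) \<otimes>\<^bsub>K\<^esub> \<theta> l)"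
      by (simp add: xy elt_mult extend_elt conjugate K.m_assoc)
    also have "\<dots> = extend \<psi> \<theta> \<kappa> x \<otimes>\<^bsub>H\<^esub> extend \<psi> \<theta> \<kappa> y"
      by (simp add: xy elt_mult extend_elt coc conjugate_mult K.m_ac)
    finally show ?thesis .
  qed
  have "inj_on (extend \<psi> \<theta> \<kappa>) (carrier H)"
  proof (rule inj_onI)
    fix x y assume x: "x \<in> carrier H" and y: "y \<in> carrier H"
      and eq: "extend \<psi> \<theta> \<kappa> x = extend \<psi> \<theta> \<kappa> y"
    then have "\<psi> (p x) = \<psi> (p y)" and *: "\<kappa> (p x) \<otimes>\<^bsub>K\<^esub> \<theta> (part x) = \<kappa> (p y) \<otimes>\<^bsub>K\<^esub> \<theta> (part y)"
      by (simp_all add: extend_def)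
    then have p: "p x = p y"
      using bij_betw_imp_inj_on[OF autoD(2)[OF \<psi>]] x y by (simp add: inj_on_eq_iff)
    with * have "\<theta> (part x) = \<theta> (part y)" using x y by simp
    then have "part x = part y"
      using bij_betw_imp_inj_on[OF autoD(2)[OF \<theta>]] x y by (simp add: inj_on_eq_iff)
    with p show "x = y" using elt_proj_part x y by metis
  qed
  moreover have "carrier H \<subseteq> extend \<psi> \<theta> \<kappa> ` carrier H"
  proof
    fix y assume y: "y \<in> carrier H"
    \<comment> \<open>The base point of the preimage is forced by \<psi>; its kernel coordinate then
      solves \<kappa>(a) \<theta>(k) = \<open>part y\<close>.\<close>
    obtain a where a: "a \<in> carrier A" "\<psi> a = p y"
      using bij_betw_imp_surj_on[OF autoD(2)[OF \<psi>]] y by (metis imageE proj.hom_closed)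
    have "inv\<^bsub>K\<^esub> \<kappa> a \<otimes>\<^bsub>K\<^esub> part y \<in> carrier K" using a y by simp
    then obtain k where k: "k \<in> carrier K" "\<theta> k = inv\<^bsub>K\<^esub> \<kappa> a \<otimes>\<^bsub>K\<^esub> part y"
      using bij_betw_imp_surj_on[OF autoD(2)[OF \<theta>]] by (metis imageE)
    have "extend \<psi> \<theta> \<kappa> (elt a k) = y"
      using a k y by (simp add: extend_elt flip: K.m_assoc)
    then show "y \<in> extend \<psi> \<theta> \<kappa> ` carrier H" using a k by (metis elt_closed imageI)
  qed
  ultimately have "bij_betw (extend \<psi> \<theta> \<kappa>) (carrier H) (carrier H)"
    using closed by (auto simp: bij_betw_def)
  moreover have "extend \<psi> \<theta> \<kappa> \<in> extensional (carrier H)" by (simp add: extend_def)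
  ultimately show ?thesis using closed mult by (auto simp: auto_def Bij_def hom_def)
qed

text \<open>The origin of \<kappa>: it measures how far \<gamma> is from commuting with the section,
  \<gamma>(s(a)) = s(\<psi>(a)) \<kappa>(a).\<close>

lemma hom_elt:
  assumes "\<gamma> \<in> hom H H" "a \<in> carrier A" "k \<in> carrier K" "\<gamma> (i k) = i (\<theta> k)"
    and "\<theta> k \<in> carrier K" "p (\<gamma> (s a)) = \<psi> a" "\<psi> a \<in> carrier A"
  shows "\<gamma> (elt a k) = elt (\<psi> a) (part (\<gamma> (s a)) \<otimes>\<^bsub>K\<^esub> \<theta> k)"
proof -
  interpret \<gamma>: group_hom H H \<gamma> by unfold_locales fact
  have "\<gamma> (elt a k) = \<gamma> (s a) \<otimes>\<^bsub>H\<^esub> i (\<theta> k)" using assms by (simp add: elt_def)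
  also have "\<gamma> (s a) = elt (\<psi> a) (part (\<gamma> (s a)))" using assms elt_proj_part[of "\<gamma> (s a)"] by simp
  finally show ?thesis using assms by (simp add: elt_mult_incl)
qed

text \<open>Converse of the multiplicativity part of \<open>extend_auto\<close>. Applying \<gamma>
  to \<open>i k\<close> times \<open>s a\<close> isolates the action, because \<kappa>(1) = 1 leaves
  only the factor \<kappa>(a) on both sides, which cancels; applying it to \<open>s a\<close> times
  \<open>s b\<close> isolates the cocycle.\<close>

lemma
  assumes \<gamma>: "\<gamma> \<in> hom H H" and \<psi>: "\<psi> \<in> hom A A" and \<theta>: "\<theta> \<in> hom K K"
    and \<kappa>: "\<kappa> \<in> carrier A \<rightarrow> carrier K"
    and elt: "\<And>a k. \<lbrakk>a \<in> carrier A; k \<in> carrier K\<rbrakk> \<Longrightarrow> \<gamma> (elt a k) = elt (\<psi> a) (\<kappa> a \<otimes>\<^bsub>K\<^esub> \<theta> k)"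
    and \<kappa>_one: "\<kappa> \<one>\<^bsub>A\<^esub> = \<one>\<^bsub>K\<^esub>"
  shows hom_elt_conjugate: "\<lbrakk>a \<in> carrier A; k \<in> carrier K\<rbrakk> \<Longrightarrow> \<theta> (conjugate a k) = conjugate (\<psi> a) (\<theta> k)"
    and hom_elt_coc: "\<lbrakk>a \<in> carrier A; b \<in> carrier A\<rbrakk> \<Longrightarrow>
      \<kappa> (a \<otimes>\<^bsub>A\<^esub> b) \<otimes>\<^bsub>K\<^esub> \<theta> (coc a b) = coc (\<psi> a) (\<psi> b) \<otimes>\<^bsub>K\<^esub> conjugate (\<psi> b) (\<kappa> a) \<otimes>\<^bsub>K\<^esub> \<kappa> b"
proof -
  interpret \<gamma>: group_hom H H \<gamma> by unfold_locales fact
  interpret \<psi>: group_hom A A \<psi> by unfold_locales fact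
  interpret \<theta>: group_hom K K \<theta> by unfold_locales fact
  have \<kappa>_closed [simp]: "\<kappa> a \<in> carrier K" if "a \<in> carrier A" for a using \<kappa> that by auto
  show "\<theta> (conjugate a k) = conjugate (\<psi> a) (\<theta> k)" if [simp]: "a \<in> carrier A" "k \<in> carrier K"
  proof -
    have "\<gamma> (elt \<one>\<^bsub>A\<^esub> k \<otimes>\<^bsub>H\<^esub> elt a \<one>\<^bsub>K\<^esub>) = \<gamma> (elt \<one>\<^bsub>A\<^esub> k) \<otimes>\<^bsub>H\<^esub> \<gamma> (elt a \<one>\<^bsub>K\<^esub>)"
      by (intro \<gamma>.hom_mult) simp_all
    then have "\<kappa> a \<otimes>\<^bsub>K\<^esub> \<theta> (conjugate a k) = conjugate (\<psi> a) (\<theta> k) \<otimes>\<^bsub>K\<^esub> \<kappa> a"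
      by (simp add: elt_mult elt \<kappa>_one del: elt_one one_elt)
    then show ?thesis by (simp add: K.m_comm[of "conjugate _ _"])
  qed
  show "\<kappa> (a \<otimes>\<^bsub>A\<^esub> b) \<otimes>\<^bsub>K\<^esub> \<theta> (coc a b) = coc (\<psi> a) (\<psi> b) \<otimes>\<^bsub>K\<^esub> conjugate (\<psi> b) (\<kappa> a) \<otimes>\<^bsub>K\<^esub> \<kappa> b"
    if [simp]: "a \<in> carrier A" "b \<in> carrier A"
  proof -
    have "\<gamma> (elt a \<one>\<^bsub>K\<^esub> \<otimes>\<^bsub>H\<^esub> elt b \<one>\<^bsub>K\<^esub>) = \<gamma> (elt a \<one>\<^bsub>K\<^esub>) \<otimes>\<^bsub>H\<^esub> \<gamma> (elt b \<one>\<^bsub>K\<^esub>)"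
      by (intro \<gamma>.hom_mult) simp_all
    then show ?thesis by (simp add: elt_mult elt del: elt_one)
  qed
qed

end

section \<open>Cocycles and coboundaries\<close>

text \<open>The coboundary formulas with explicit witnesses and without membership in the cocycles.
  The witnesses can then be multiplied and inverted along with the cochains, and reused as the
  \<kappa> of a lift.\<close>

definition cobounds ::
    "('a, 'b) rrb \<Rightarrow> ('k, 'l) rrb \<Rightarrow> ('a, 'b, 'k, 'l) rrb_action \<Rightarrow> ('a \<Rightarrow> 'k) \<Rightarrow> ('b \<Rightarrow> 'l) \<Rightarrow>
     ('a, 'b, 'k, 'l) rrb_cochain \<Rightarrow> bool" where
  "cobounds A K M \<kappa>\<^sub>1 \<kappa>\<^sub>2 c \<longleftrightarrow>
     \<kappa>\<^sub>1 \<in> carrier (rH A) \<rightarrow> carrier (rH K) \<and> \<kappa>\<^sub>2 \<in> carrier (rG A) \<rightarrow> carrier (rG K) \<and>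
     \<kappa>\<^sub>1 \<one>\<^bsub>rH A\<^esub> = \<one>\<^bsub>rH K\<^esub> \<and> \<kappa>\<^sub>2 \<one>\<^bsub>rG A\<^esub> = \<one>\<^bsub>rG K\<^esub> \<and>
     (\<forall>a \<in> carrier (rH A). \<forall>b \<in> carrier (rH A). fst c (a, b) =
        inv\<^bsub>rH K\<^esub> (\<kappa>\<^sub>1 (a \<otimes>\<^bsub>rH A\<^esub> b)) \<otimes>\<^bsub>rH K\<^esub> \<kappa>\<^sub>1 b \<otimes>\<^bsub>rH K\<^esub> act_mu M b (\<kappa>\<^sub>1 a)) \<and>
     (\<forall>a \<in> carrier (rG A). \<forall>b \<in> carrier (rG A). fst (snd c) (a, b) =
        inv\<^bsub>rG K\<^esub> (\<kappa>\<^sub>2 (a \<otimes>\<^bsub>rG A\<^esub> b)) \<otimes>\<^bsub>rG K\<^esub> \<kappa>\<^sub>2 b \<otimes>\<^bsub>rG K\<^esub> act_sigma M b (\<kappa>\<^sub>2 a)) \<and>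
     (\<forall>a \<in> carrier (rH A). \<forall>b \<in> carrier (rG A). fst (snd (snd c)) (a, b) =
        act_nu M b (act_f M (\<kappa>\<^sub>2 b) a \<otimes>\<^bsub>rH K\<^esub> \<kappa>\<^sub>1 a) \<otimes>\<^bsub>rH K\<^esub> inv\<^bsub>rH K\<^esub> (\<kappa>\<^sub>1 (rphi A b a))) \<and>
     (\<forall>a \<in> carrier (rH A). snd (snd (snd c)) a =
        rR K (nu_inv K M (rR A a) (\<kappa>\<^sub>1 a)) \<otimes>\<^bsub>rG K\<^esub> inv\<^bsub>rG K\<^esub> (\<kappa>\<^sub>2 (rR A a)))"

lemma rrb_B2_iff:
  "c \<in> rrb_B2 A K M \<longleftrightarrow> c \<in> rrb_Z2 A K M \<and> (\<exists>\<kappa>\<^sub>1 \<kappa>\<^sub>2. cobounds A K M \<kappa>\<^sub>1 \<kappa>\<^sub>2 c)"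
  by (cases c) (simp add: rrb_B2_def cobounds_def Let_def Bex_def, blast)

text \<open>Multiplication of cochains does not involve the action, so the classes for
  \<open>M\<close> and for the twisted action are cosets in the same group.\<close>

lemma rrb_class_eq: "rrb_class A K M c = rrb_B2 A K M #>\<^bsub>rrb_C2 A K\<^esub> c"
  by (simp add: rrb_class_def r_coset_def rrb_Z2_group_def)

lemma rrb_class_in_H2: "c \<in> rrb_Z2 A K M \<Longrightarrow> rrb_class A K M c \<in> carrier (rrb_H2 A K M)"
  by (auto simp: rrb_H2_def FactGroup_def RCOSETS_def rrb_class_def rrb_Z2_group_def)

text \<open>Collects the linearity of the action: with the arguments from A and B fixed, each map is
  a homomorphism in its argument from K or L, and each \<nu> is bijective. In this form it passes at
  once to the twisted action.\<close>

locale rrb_module =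
  fixes A :: "('a, 'b) rrb" and K :: "('k, 'l) rrb" and M :: "('a, 'b, 'k, 'l) rrb_action"
  assumes group_A: "group (rH A)" "group (rG A)"
    and comm_group_K: "comm_group (rH K)" "comm_group (rG K)"
    and phi_closed [simp]: "\<lbrakk>b \<in> carrier (rG A); a \<in> carrier (rH A)\<rbrakk> \<Longrightarrow> rphi A b a \<in> carrier (rH A)"
    and R_closed [simp]: "a \<in> carrier (rH A) \<Longrightarrow> rR A a \<in> carrier (rG A)"
    and S_hom: "rR K \<in> hom (rH K) (rG K)"
    and nu_hom: "b \<in> carrier (rG A) \<Longrightarrow> act_nu M b \<in> hom (rH K) (rH K)"
    and nu_bij: "b \<in> carrier (rG A) \<Longrightarrow> bij_betw (act_nu M b) (carrier (rH K)) (carrier (rH K))"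
    and mu_hom: "a \<in> carrier (rH A) \<Longrightarrow> act_mu M a \<in> hom (rH K) (rH K)"
    and sigma_hom: "b \<in> carrier (rG A) \<Longrightarrow> act_sigma M b \<in> hom (rG K) (rG K)"
    and f_hom: "a \<in> carrier (rH A) \<Longrightarrow> (\<lambda>l. act_f M l a) \<in> hom (rG K) (rH K)"
begin

sublocale AH: group "rH A" by (rule group_A)
sublocale AG: group "rG A" by (rule group_A)
sublocale KH: comm_group "rH K" by (rule comm_group_K)
sublocale KG: comm_group "rG K" by (rule comm_group_K)
sublocale S: group_hom "rH K" "rG K" "rR K" by unfold_locales (rule S_hom)

lemma nu_inv_hom:
  assumes b: "b \<in> carrier (rG A)"
  shows "nu_inv K M b \<in> hom (rH K) (rH K)"
proof -
  have "act_nu M b \<in> iso (rH K) (rH K)" using nu_hom[OF b] nu_bij[OF b] by (simp add: iso_def)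
  then have "inv_into (carrier (rH K)) (act_nu M b) \<in> iso (rH K) (rH K)"
    by (rule KH.iso_set_sym)
  then show ?thesis by (simp add: nu_inv_def iso_def)
qed

lemma action_closed [simp]:
  "\<lbrakk>b \<in> carrier (rG A); k \<in> carrier (rH K)\<rbrakk> \<Longrightarrow> act_nu M b k \<in> carrier (rH K)"
  "\<lbrakk>a \<in> carrier (rH A); k \<in> carrier (rH K)\<rbrakk> \<Longrightarrow> act_mu M a k \<in> carrier (rH K)"
  "\<lbrakk>b \<in> carrier (rG A); l \<in> carrier (rG K)\<rbrakk> \<Longrightarrow> act_sigma M b l \<in> carrier (rG K)"
  "\<lbrakk>a \<in> carrier (rH A); l \<in> carrier (rG K)\<rbrakk> \<Longrightarrow> act_f M l a \<in> carrier (rH K)"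
  "\<lbrakk>b \<in> carrier (rG A); k \<in> carrier (rH K)\<rbrakk> \<Longrightarrow> nu_inv K M b k \<in> carrier (rH K)"
  by (simp_all add: hom_in_carrier[OF nu_hom] hom_in_carrier[OF mu_hom] hom_in_carrier[OF sigma_hom]
      hom_in_carrier[OF f_hom] hom_in_carrier[OF nu_inv_hom])

lemma action_mult [simp]:
  "\<lbrakk>b \<in> carrier (rG A); k \<in> carrier (rH K); k' \<in> carrier (rH K)\<rbrakk> \<Longrightarrow>
     act_nu M b (k \<otimes>\<^bsub>rH K\<^esub> k') = act_nu M b k \<otimes>\<^bsub>rH K\<^esub> act_nu M b k'"
  "\<lbrakk>a \<in> carrier (rH A); k \<in> carrier (rH K); k' \<in> carrier (rH K)\<rbrakk> \<Longrightarrow>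
     act_mu M a (k \<otimes>\<^bsub>rH K\<^esub> k') = act_mu M a k \<otimes>\<^bsub>rH K\<^esub> act_mu M a k'"
  "\<lbrakk>b \<in> carrier (rG A); l \<in> carrier (rG K); l' \<in> carrier (rG K)\<rbrakk> \<Longrightarrow>
     act_sigma M b (l \<otimes>\<^bsub>rG K\<^esub> l') = act_sigma M b l \<otimes>\<^bsub>rG K\<^esub> act_sigma M b l'"
  "\<lbrakk>a \<in> carrier (rH A); l \<in> carrier (rG K); l' \<in> carrier (rG K)\<rbrakk> \<Longrightarrow>
     act_f M (l \<otimes>\<^bsub>rG K\<^esub> l') a = act_f M l a \<otimes>\<^bsub>rH K\<^esub> act_f M l' a"
  "\<lbrakk>b \<in> carrier (rG A); k \<in> carrier (rH K); k' \<in> carrier (rH K)\<rbrakk> \<Longrightarrow>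
     nu_inv K M b (k \<otimes>\<^bsub>rH K\<^esub> k') = nu_inv K M b k \<otimes>\<^bsub>rH K\<^esub> nu_inv K M b k'"
  by (simp_all add: hom_mult[OF nu_hom] hom_mult[OF mu_hom] hom_mult[OF sigma_hom]
      hom_mult[OF f_hom] hom_mult[OF nu_inv_hom])

lemma action_one [simp]:
  "b \<in> carrier (rG A) \<Longrightarrow> act_nu M b \<one>\<^bsub>rH K\<^esub> = \<one>\<^bsub>rH K\<^esub>"
  "a \<in> carrier (rH A) \<Longrightarrow> act_mu M a \<one>\<^bsub>rH K\<^esub> = \<one>\<^bsub>rH K\<^esub>"
  "b \<in> carrier (rG A) \<Longrightarrow> act_sigma M b \<one>\<^bsub>rG K\<^esub> = \<one>\<^bsub>rG K\<^esub>"
  "a \<in> carrier (rH A) \<Longrightarrow> act_f M \<one>\<^bsub>rG K\<^esub> a = \<one>\<^bsub>rH K\<^esub>"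
  "b \<in> carrier (rG A) \<Longrightarrow> nu_inv K M b \<one>\<^bsub>rH K\<^esub> = \<one>\<^bsub>rH K\<^esub>"
  using hom_one[OF nu_hom] hom_one[OF mu_hom] hom_one[OF sigma_hom] hom_one[OF f_hom]
    hom_one[OF nu_inv_hom] KH.is_group KG.is_group by auto

lemma action_inv [simp]:
  "\<lbrakk>b \<in> carrier (rG A); k \<in> carrier (rH K)\<rbrakk> \<Longrightarrow>
     act_nu M b (inv\<^bsub>rH K\<^esub> k) = inv\<^bsub>rH K\<^esub> act_nu M b k"
  "\<lbrakk>a \<in> carrier (rH A); k \<in> carrier (rH K)\<rbrakk> \<Longrightarrow>
     act_mu M a (inv\<^bsub>rH K\<^esub> k) = inv\<^bsub>rH K\<^esub> act_mu M a k"
  "\<lbrakk>b \<in> carrier (rG A); l \<in> carrier (rG K)\<rbrakk> \<Longrightarrow>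
     act_sigma M b (inv\<^bsub>rG K\<^esub> l) = inv\<^bsub>rG K\<^esub> act_sigma M b l"
  "\<lbrakk>a \<in> carrier (rH A); l \<in> carrier (rG K)\<rbrakk> \<Longrightarrow>
     act_f M (inv\<^bsub>rG K\<^esub> l) a = inv\<^bsub>rH K\<^esub> act_f M l a"
  "\<lbrakk>b \<in> carrier (rG A); k \<in> carrier (rH K)\<rbrakk> \<Longrightarrow>
     nu_inv K M b (inv\<^bsub>rH K\<^esub> k) = inv\<^bsub>rH K\<^esub> nu_inv K M b k"
  by (rule sym, rule KH.inv_equality KG.inv_equality, simp_all flip: action_mult)+

lemma nu_nu_inv [simp]:
  "\<lbrakk>b \<in> carrier (rG A); k \<in> carrier (rH K)\<rbrakk> \<Longrightarrow> act_nu M b (nu_inv K M b k) = k"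
  using nu_bij[of b] by (simp add: nu_inv_def bij_betw_def f_inv_into_f)

section \<open>The group of normalized 2-cochains\<close>

lemma C2_PiE:
  assumes "c \<in> carrier (rrb_C2 A K)"
  shows "fst c \<in> carrier (rH A) \<times> carrier (rH A) \<rightarrow>\<^sub>E carrier (rH K)"
    and "fst (snd c) \<in> carrier (rG A) \<times> carrier (rG A) \<rightarrow>\<^sub>E carrier (rG K)"
    and "fst (snd (snd c)) \<in> carrier (rH A) \<times> carrier (rG A) \<rightarrow>\<^sub>E carrier (rH K)"
    and "snd (snd (snd c)) \<in> carrier (rH A) \<rightarrow>\<^sub>E carrier (rG K)"
  using assms by (cases c, simp add: rrb_C2_def Let_def)+

lemma C2_eval_closed [simp]:
  assumes "c \<in> carrier (rrb_C2 A K)"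
  shows "\<lbrakk>a \<in> carrier (rH A); a' \<in> carrier (rH A)\<rbrakk> \<Longrightarrow> fst c (a, a') \<in> carrier (rH K)"
    and "\<lbrakk>b \<in> carrier (rG A); b' \<in> carrier (rG A)\<rbrakk> \<Longrightarrow> fst (snd c) (b, b') \<in> carrier (rG K)"
    and "\<lbrakk>a \<in> carrier (rH A); b \<in> carrier (rG A)\<rbrakk> \<Longrightarrow> fst (snd (snd c)) (a, b) \<in> carrier (rH K)"
    and "a \<in> carrier (rH A) \<Longrightarrow> snd (snd (snd c)) a \<in> carrier (rG K)"
  using C2_PiE[OF assms] by (simp_all add: PiE_iff)

lemma C2_eval_mult [simp]:
  shows "\<lbrakk>a \<in> carrier (rH A); a' \<in> carrier (rH A)\<rbrakk> \<Longrightarrow>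
      fst (c \<otimes>\<^bsub>rrb_C2 A K\<^esub> d) (a, a') = fst c (a, a') \<otimes>\<^bsub>rH K\<^esub> fst d (a, a')"
    and "\<lbrakk>b \<in> carrier (rG A); b' \<in> carrier (rG A)\<rbrakk> \<Longrightarrow>
      fst (snd (c \<otimes>\<^bsub>rrb_C2 A K\<^esub> d)) (b, b') = fst (snd c) (b, b') \<otimes>\<^bsub>rG K\<^esub> fst (snd d) (b, b')"
    and "\<lbrakk>a \<in> carrier (rH A); b \<in> carrier (rG A)\<rbrakk> \<Longrightarrow>
      fst (snd (snd (c \<otimes>\<^bsub>rrb_C2 A K\<^esub> d))) (a, b) =
      fst (snd (snd c)) (a, b) \<otimes>\<^bsub>rH K\<^esub> fst (snd (snd d)) (a, b)"
    and "a \<in> carrier (rH A) \<Longrightarrow> snd (snd (snd (c \<otimes>\<^bsub>rrb_C2 A K\<^esub> d))) a =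
      snd (snd (snd c)) a \<otimes>\<^bsub>rG K\<^esub> snd (snd (snd d)) a"
  by (simp_all add: rrb_C2_def Let_def split: prod.splits)

lemma C2_eqI:
  assumes c: "c \<in> carrier (rrb_C2 A K)" and d: "d \<in> carrier (rrb_C2 A K)"
    and "\<And>a a'. \<lbrakk>a \<in> carrier (rH A); a' \<in> carrier (rH A)\<rbrakk> \<Longrightarrow> fst c (a, a') = fst d (a, a')"
    and "\<And>b b'. \<lbrakk>b \<in> carrier (rG A); b' \<in> carrier (rG A)\<rbrakk> \<Longrightarrow>
      fst (snd c) (b, b') = fst (snd d) (b, b')"
    and "\<And>a b. \<lbrakk>a \<in> carrier (rH A); b \<in> carrier (rG A)\<rbrakk> \<Longrightarrow>
      fst (snd (snd c)) (a, b) = fst (snd (snd d)) (a, b)"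
    and "\<And>a. a \<in> carrier (rH A) \<Longrightarrow> snd (snd (snd c)) a = snd (snd (snd d)) a"
  shows "c = d"
proof (intro prod_eqI)
  show "fst c = fst d"
    by (rule PiE_ext[OF C2_PiE(1)[OF c] C2_PiE(1)[OF d]]) (auto simp: assms(3))
  show "fst (snd c) = fst (snd d)"
    by (rule PiE_ext[OF C2_PiE(2)[OF c] C2_PiE(2)[OF d]]) (auto simp: assms(4))
  show "fst (snd (snd c)) = fst (snd (snd d))"
    by (rule PiE_ext[OF C2_PiE(3)[OF c] C2_PiE(3)[OF d]]) (auto simp: assms(5))
  show "snd (snd (snd c)) = snd (snd (snd d))"
    by (rule PiE_ext[OF C2_PiE(4)[OF c] C2_PiE(4)[OF d]]) (auto simp: assms(6))
qed

lemma C2_mult_closed: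
  "\<lbrakk>c \<in> carrier (rrb_C2 A K); d \<in> carrier (rrb_C2 A K)\<rbrakk> \<Longrightarrow>
    c \<otimes>\<^bsub>rrb_C2 A K\<^esub> d \<in> carrier (rrb_C2 A K)"
  by (auto simp: rrb_C2_def Let_def PiE_iff)

lemma C2_one_closed: "\<one>\<^bsub>rrb_C2 A K\<^esub> \<in> carrier (rrb_C2 A K)"
  by (auto simp: rrb_C2_def Let_def)

lemma C2_eval_one:
  shows "\<lbrakk>a \<in> carrier (rH A); a' \<in> carrier (rH A)\<rbrakk> \<Longrightarrow> fst \<one>\<^bsub>rrb_C2 A K\<^esub> (a, a') = \<one>\<^bsub>rH K\<^esub>"
    and "\<lbrakk>b \<in> carrier (rG A); b' \<in> carrier (rG A)\<rbrakk> \<Longrightarrow> fst (snd \<one>\<^bsub>rrb_C2 A K\<^esub>) (b, b') = \<one>\<^bsub>rG K\<^esub>"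
    and "\<lbrakk>a \<in> carrier (rH A); b \<in> carrier (rG A)\<rbrakk> \<Longrightarrow> fst (snd (snd \<one>\<^bsub>rrb_C2 A K\<^esub>)) (a, b) = \<one>\<^bsub>rH K\<^esub>"
    and "a \<in> carrier (rH A) \<Longrightarrow> snd (snd (snd \<one>\<^bsub>rrb_C2 A K\<^esub>)) a = \<one>\<^bsub>rG K\<^esub>"
  by (simp_all add: rrb_C2_def Let_def)

lemma C2_left_inverse:
  assumes c: "c \<in> carrier (rrb_C2 A K)"
  shows "\<exists>d \<in> carrier (rrb_C2 A K). d \<otimes>\<^bsub>rrb_C2 A K\<^esub> c = \<one>\<^bsub>rrb_C2 A K\<^esub>"
proof
  let ?d = "(\<lambda>x \<in> carrier (rH A) \<times> carrier (rH A). inv\<^bsub>rH K\<^esub> fst c x,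
    \<lambda>x \<in> carrier (rG A) \<times> carrier (rG A). inv\<^bsub>rG K\<^esub> fst (snd c) x,
    \<lambda>x \<in> carrier (rH A) \<times> carrier (rG A). inv\<^bsub>rH K\<^esub> fst (snd (snd c)) x,
    \<lambda>x \<in> carrier (rH A). inv\<^bsub>rG K\<^esub> snd (snd (snd c)) x)"
  show d: "?d \<in> carrier (rrb_C2 A K)"
    using c by (auto simp: rrb_C2_def Let_def PiE_iff)
  show "?d \<otimes>\<^bsub>rrb_C2 A K\<^esub> c = \<one>\<^bsub>rrb_C2 A K\<^esub>"
    using c by (intro C2_eqI C2_mult_closed C2_one_closed d) (simp_all add: C2_eval_one)
qed

sublocale C2: group "rrb_C2 A K"
proof (rule groupI)
  show "x \<otimes>\<^bsub>rrb_C2 A K\<^esub> y \<otimes>\<^bsub>rrb_C2 A K\<^esub> z = x \<otimes>\<^bsub>rrb_C2 A K\<^esub> (y \<otimes>\<^bsub>rrb_C2 A K\<^esub> z)"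
    if "x \<in> carrier (rrb_C2 A K)" "y \<in> carrier (rrb_C2 A K)" "z \<in> carrier (rrb_C2 A K)" for x y z
    using that by (intro C2_eqI C2_mult_closed) (simp_all add: KH.m_assoc KG.m_assoc)
  show "\<one>\<^bsub>rrb_C2 A K\<^esub> \<otimes>\<^bsub>rrb_C2 A K\<^esub> x = x" if "x \<in> carrier (rrb_C2 A K)" for x
    using that by (intro C2_eqI C2_mult_closed C2_one_closed) (simp_all add: C2_eval_one)
qed (auto intro: C2_mult_closed C2_one_closed C2_left_inverse)

lemma C2_eval_hom:
  shows "\<lbrakk>a \<in> carrier (rH A); a' \<in> carrier (rH A)\<rbrakk> \<Longrightarrow>
      (\<lambda>c. fst c (a, a')) \<in> hom (rrb_C2 A K) (rH K)"
    and "\<lbrakk>b \<in> carrier (rG A); b' \<in> carrier (rG A)\<rbrakk> \<Longrightarrow>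
      (\<lambda>c. fst (snd c) (b, b')) \<in> hom (rrb_C2 A K) (rG K)"
    and "\<lbrakk>a \<in> carrier (rH A); b \<in> carrier (rG A)\<rbrakk> \<Longrightarrow>
      (\<lambda>c. fst (snd (snd c)) (a, b)) \<in> hom (rrb_C2 A K) (rH K)"
    and "a \<in> carrier (rH A) \<Longrightarrow> (\<lambda>c. snd (snd (snd c)) a) \<in> hom (rrb_C2 A K) (rG K)"
  by (simp_all add: hom_def)

lemma C2_eval_inv [simp]:
  assumes "c \<in> carrier (rrb_C2 A K)"
  shows "\<lbrakk>a \<in> carrier (rH A); a' \<in> carrier (rH A)\<rbrakk> \<Longrightarrow>
      fst (inv\<^bsub>rrb_C2 A K\<^esub> c) (a, a') = inv\<^bsub>rH K\<^esub> fst c (a, a')"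
    and "\<lbrakk>b \<in> carrier (rG A); b' \<in> carrier (rG A)\<rbrakk> \<Longrightarrow>
      fst (snd (inv\<^bsub>rrb_C2 A K\<^esub> c)) (b, b') = inv\<^bsub>rG K\<^esub> fst (snd c) (b, b')"
    and "\<lbrakk>a \<in> carrier (rH A); b \<in> carrier (rG A)\<rbrakk> \<Longrightarrow>
      fst (snd (snd (inv\<^bsub>rrb_C2 A K\<^esub> c))) (a, b) = inv\<^bsub>rH K\<^esub> fst (snd (snd c)) (a, b)"
    and "a \<in> carrier (rH A) \<Longrightarrow>
      snd (snd (snd (inv\<^bsub>rrb_C2 A K\<^esub> c))) a = inv\<^bsub>rG K\<^esub> snd (snd (snd c)) a"
  by (rule group_hom.hom_inv[OF group_hom.intro[OF C2.is_group KH.is_group] assms]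
      group_hom.hom_inv[OF group_hom.intro[OF C2.is_group KG.is_group] assms],
      simp add: group_hom_axioms_def C2_eval_hom)+

section \<open>The subgroups of cocycles and coboundaries\<close>

lemma circ_closed [simp]:
  "\<lbrakk>a \<in> carrier (rH A); b \<in> carrier (rH A)\<rbrakk> \<Longrightarrow> circ_T A a b \<in> carrier (rH A)"
  by (simp add: circ_T_def)

text \<open>Projections in place of tuple patterns make each side of a condition a function of
  \<open>c\<close>, built from the evaluations of \<open>C2_eval_hom\<close>.\<close>

lemma Z2_iff:
  "c \<in> rrb_Z2 A K M \<longleftrightarrow> c \<in> carrier (rrb_C2 A K) \<and>
    (\<forall>a \<in> carrier (rH A). \<forall>b \<in> carrier (rH A). \<forall>d \<in> carrier (rH A).
      fst c (b, d) \<otimes>\<^bsub>rH K\<^esub> fst c (a, b \<otimes>\<^bsub>rH A\<^esub> d)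
      = fst c (a \<otimes>\<^bsub>rH A\<^esub> b, d) \<otimes>\<^bsub>rH K\<^esub> act_mu M d (fst c (a, b))) \<and>
    (\<forall>a \<in> carrier (rG A). \<forall>b \<in> carrier (rG A). \<forall>d \<in> carrier (rG A).
      fst (snd c) (b, d) \<otimes>\<^bsub>rG K\<^esub> fst (snd c) (a, b \<otimes>\<^bsub>rG A\<^esub> d)
      = fst (snd c) (a \<otimes>\<^bsub>rG A\<^esub> b, d) \<otimes>\<^bsub>rG K\<^esub> act_sigma M d (fst (snd c) (a, b))) \<and>
    (\<forall>a \<in> carrier (rH A). \<forall>b \<in> carrier (rG A). \<forall>d \<in> carrier (rG A).
      fst (snd (snd c)) (rphi A d a, b) \<otimes>\<^bsub>rH K\<^esub> act_nu M b (fst (snd (snd c)) (a, d))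
      = fst (snd (snd c)) (a, b \<otimes>\<^bsub>rG A\<^esub> d)
        \<otimes>\<^bsub>rH K\<^esub> act_nu M (b \<otimes>\<^bsub>rG A\<^esub> d) (act_f M (fst (snd c) (b, d)) a)) \<and>
    (\<forall>a \<in> carrier (rH A). \<forall>b \<in> carrier (rH A). \<forall>d \<in> carrier (rG A).
      fst (snd (snd c)) (a \<otimes>\<^bsub>rH A\<^esub> b, d) \<otimes>\<^bsub>rH K\<^esub> act_nu M d (fst c (a, b))
      = act_mu M (rphi A d b) (fst (snd (snd c)) (a, d)) \<otimes>\<^bsub>rH K\<^esub> fst (snd (snd c)) (b, d)
        \<otimes>\<^bsub>rH K\<^esub> fst c (rphi A d a, rphi A d b)) \<and>
    (\<forall>a \<in> carrier (rH A). \<forall>b \<in> carrier (rH A).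
      fst (snd c) (rR A a, rR A b) \<otimes>\<^bsub>rG K\<^esub> snd (snd (snd c)) b
        \<otimes>\<^bsub>rG K\<^esub> inv\<^bsub>rG K\<^esub> (snd (snd (snd c)) (circ_T A a b))
        \<otimes>\<^bsub>rG K\<^esub> act_sigma M (rR A b) (snd (snd (snd c)) a)
      = rR K (nu_inv K M (rR A (circ_T A a b))
          (fst (snd (snd c)) (b, rR A a) \<otimes>\<^bsub>rH K\<^esub> fst c (a, rphi A (rR A a) b)
            \<otimes>\<^bsub>rH K\<^esub> act_nu M (rR A a) (act_f M (snd (snd (snd c)) a) b))))"
  by (cases c) (simp add: rrb_Z2_def Let_def)

lemmas Z2_conditions = Z2_iff[THEN iffD1, THEN conjunct2]

lemmas Z2D =
  Z2_conditions[THEN conjunct1, rule_format]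
  Z2_conditions[THEN conjunct2, THEN conjunct1, rule_format]
  Z2_conditions[THEN conjunct2, THEN conjunct2, THEN conjunct1, rule_format]
  Z2_conditions[THEN conjunct2, THEN conjunct2, THEN conjunct2, THEN conjunct1, rule_format]
  Z2_conditions[THEN conjunct2, THEN conjunct2, THEN conjunct2, THEN conjunct2, rule_format]

lemma Z2_imp_C2: "c \<in> rrb_Z2 A K M \<Longrightarrow> c \<in> carrier (rrb_C2 A K)"
  by (simp add: Z2_iff)

text \<open>At fixed arguments, both sides of each condition are homomorphisms from the cochain
  group to K or L: they arise from evaluations by products, inverses and the linear action maps.
  Each condition therefore cuts out an equalizer, and the cocycles are the intersection of the
  five.\<close>

lemma subgroup_Z2: "subgroup (rrb_Z2 A K M) (rrb_C2 A K)"
proof -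
  let ?C = "rrb_C2 A K"
  have KH_mult: "(\<lambda>c. f c \<otimes>\<^bsub>rH K\<^esub> g c) \<in> hom ?C (rH K)"
    if "f \<in> hom ?C (rH K)" "g \<in> hom ?C (rH K)" for f g
    using that by (rule KH.hom_multI[OF C2.is_group])
  have KG_mult: "(\<lambda>c. f c \<otimes>\<^bsub>rG K\<^esub> g c) \<in> hom ?C (rG K)"
    if "f \<in> hom ?C (rG K)" "g \<in> hom ?C (rG K)" for f g
    using that by (rule KG.hom_multI[OF C2.is_group])
  have KG_inv: "(\<lambda>c. inv\<^bsub>rG K\<^esub> f c) \<in> hom ?C (rG K)" if "f \<in> hom ?C (rG K)" for f
    using that by (rule KG.hom_invI[OF C2.is_group])
  have mu: "(\<lambda>c. act_mu M a (f c)) \<in> hom ?C (rH K)"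
    if "a \<in> carrier (rH A)" "f \<in> hom ?C (rH K)" for a f
    using hom_compose[OF that(2) mu_hom[OF that(1)]] by (simp add: comp_def)
  have nu: "(\<lambda>c. act_nu M b (f c)) \<in> hom ?C (rH K)"
    if "b \<in> carrier (rG A)" "f \<in> hom ?C (rH K)" for b f
    using hom_compose[OF that(2) nu_hom[OF that(1)]] by (simp add: comp_def)
  have nu_inv: "(\<lambda>c. nu_inv K M b (f c)) \<in> hom ?C (rH K)"
    if "b \<in> carrier (rG A)" "f \<in> hom ?C (rH K)" for b f
    using hom_compose[OF that(2) nu_inv_hom[OF that(1)]] by (simp add: comp_def)
  have sigma: "(\<lambda>c. act_sigma M b (f c)) \<in> hom ?C (rG K)"
    if "b \<in> carrier (rG A)" "f \<in> hom ?C (rG K)" for b f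
    using hom_compose[OF that(2) sigma_hom[OF that(1)]] by (simp add: comp_def)
  have f: "(\<lambda>c. act_f M (f c) a) \<in> hom ?C (rH K)"
    if "a \<in> carrier (rH A)" "f \<in> hom ?C (rG K)" for a f
    using hom_compose[OF that(2) f_hom[OF that(1)]] by (simp add: comp_def)
  have S: "(\<lambda>c. rR K (f c)) \<in> hom ?C (rG K)" if "f \<in> hom ?C (rH K)" for f
    using hom_compose[OF that S_hom] by (simp add: comp_def)
  note homs = KH_mult KG_mult KG_inv mu nu nu_inv sigma f S C2_eval_hom
  let ?A = "carrier (rH A)" and ?B = "carrier (rG A)"
  \<comment> \<open>The quantified arguments are packed into a tuple, which is the index in
    \<open>subgroup_equalizers\<close>.\<close>
  have Z1: "subgroup {c \<in> carrier ?C. \<forall>(a, b, d) \<in> ?A \<times> ?A \<times> ?A.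
      fst c (b, d) \<otimes>\<^bsub>rH K\<^esub> fst c (a, b \<otimes>\<^bsub>rH A\<^esub> d)
      = fst c (a \<otimes>\<^bsub>rH A\<^esub> b, d) \<otimes>\<^bsub>rH K\<^esub> act_mu M d (fst c (a, b))} ?C"
    unfolding split_beta by (rule C2.subgroup_equalizers[OF KH.is_group]; intro homs; auto)
  have Z2: "subgroup {c \<in> carrier ?C. \<forall>(a, b, d) \<in> ?B \<times> ?B \<times> ?B.
      fst (snd c) (b, d) \<otimes>\<^bsub>rG K\<^esub> fst (snd c) (a, b \<otimes>\<^bsub>rG A\<^esub> d)
      = fst (snd c) (a \<otimes>\<^bsub>rG A\<^esub> b, d) \<otimes>\<^bsub>rG K\<^esub> act_sigma M d (fst (snd c) (a, b))} ?C"
    unfolding split_beta by (rule C2.subgroup_equalizers[OF KG.is_group]; intro homs; auto)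
  have Z3: "subgroup {c \<in> carrier ?C. \<forall>(a, b, d) \<in> ?A \<times> ?B \<times> ?B.
      fst (snd (snd c)) (rphi A d a, b) \<otimes>\<^bsub>rH K\<^esub> act_nu M b (fst (snd (snd c)) (a, d))
      = fst (snd (snd c)) (a, b \<otimes>\<^bsub>rG A\<^esub> d)
        \<otimes>\<^bsub>rH K\<^esub> act_nu M (b \<otimes>\<^bsub>rG A\<^esub> d) (act_f M (fst (snd c) (b, d)) a)} ?C"
    unfolding split_beta by (rule C2.subgroup_equalizers[OF KH.is_group]; intro homs; auto)
  have Z4: "subgroup {c \<in> carrier ?C. \<forall>(a, b, d) \<in> ?A \<times> ?A \<times> ?B.
      fst (snd (snd c)) (a \<otimes>\<^bsub>rH A\<^esub> b, d) \<otimes>\<^bsub>rH K\<^esub> act_nu M d (fst c (a, b))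
      = act_mu M (rphi A d b) (fst (snd (snd c)) (a, d)) \<otimes>\<^bsub>rH K\<^esub> fst (snd (snd c)) (b, d)
        \<otimes>\<^bsub>rH K\<^esub> fst c (rphi A d a, rphi A d b)} ?C"
    unfolding split_beta by (rule C2.subgroup_equalizers[OF KH.is_group]; intro homs; auto)
  have Z5: "subgroup {c \<in> carrier ?C. \<forall>(a, b) \<in> ?A \<times> ?A.
      fst (snd c) (rR A a, rR A b) \<otimes>\<^bsub>rG K\<^esub> snd (snd (snd c)) b
        \<otimes>\<^bsub>rG K\<^esub> inv\<^bsub>rG K\<^esub> (snd (snd (snd c)) (circ_T A a b))
        \<otimes>\<^bsub>rG K\<^esub> act_sigma M (rR A b) (snd (snd (snd c)) a)
      = rR K (nu_inv K M (rR A (circ_T A a b))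
          (fst (snd (snd c)) (b, rR A a) \<otimes>\<^bsub>rH K\<^esub> fst c (a, rphi A (rR A a) b)
            \<otimes>\<^bsub>rH K\<^esub> act_nu M (rR A a) (act_f M (snd (snd (snd c)) a) b)))} ?C"
    unfolding split_beta by (rule C2.subgroup_equalizers[OF KG.is_group]; intro homs; auto)
  from C2.subgroups_Inter_pair[OF Z1 C2.subgroups_Inter_pair[OF Z2 C2.subgroups_Inter_pair[OF Z3
    C2.subgroups_Inter_pair[OF Z4 Z5]]]]
  show ?thesis
    by (rule back_subst[where P = "\<lambda>X. subgroup X ?C"]) (simp add: set_eq_iff Z2_iff, blast)
qed

lemma cobounds_mult:
  assumes "c \<in> carrier (rrb_C2 A K)" "d \<in> carrier (rrb_C2 A K)"
    and "cobounds A K M \<kappa>\<^sub>1 \<kappa>\<^sub>2 c" "cobounds A K M \<kappa>\<^sub>1' \<kappa>\<^sub>2' d"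
  shows "cobounds A K M (\<lambda>a. \<kappa>\<^sub>1 a \<otimes>\<^bsub>rH K\<^esub> \<kappa>\<^sub>1' a) (\<lambda>b. \<kappa>\<^sub>2 b \<otimes>\<^bsub>rG K\<^esub> \<kappa>\<^sub>2' b) (c \<otimes>\<^bsub>rrb_C2 A K\<^esub> d)"
  using assms
  by (simp add: cobounds_def split_beta Pi_iff KH.inv_mult KG.inv_mult KH.m_ac KG.m_ac)

lemma cobounds_inv:
  assumes "c \<in> carrier (rrb_C2 A K)" and "cobounds A K M \<kappa>\<^sub>1 \<kappa>\<^sub>2 c"
  shows "cobounds A K M (\<lambda>a. inv\<^bsub>rH K\<^esub> \<kappa>\<^sub>1 a) (\<lambda>b. inv\<^bsub>rG K\<^esub> \<kappa>\<^sub>2 b) (inv\<^bsub>rrb_C2 A K\<^esub> c)"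
  using assms
  by (simp add: cobounds_def split_beta Pi_iff KH.inv_mult KG.inv_mult)

lemma cobounds_one: "cobounds A K M (\<lambda>_. \<one>\<^bsub>rH K\<^esub>) (\<lambda>_. \<one>\<^bsub>rG K\<^esub>) \<one>\<^bsub>rrb_C2 A K\<^esub>"
  by (simp add: cobounds_def split_beta C2_eval_one)

text \<open>Membership in \<open>rrb_B2\<close> has a cocycle part and a witness part; the first is
  inherited from \<open>subgroup_Z2\<close>, the second from the three \<open>cobounds\<close>
  lemmas.\<close>

lemma subgroup_B2: "subgroup (rrb_B2 A K M) (rrb_C2 A K)"
proof -
  interpret Z2: subgroup "rrb_Z2 A K M" "rrb_C2 A K" by (rule subgroup_Z2)
  show ?thesis
  proof
    show "rrb_B2 A K M \<subseteq> carrier (rrb_C2 A K)" by (auto simp: rrb_B2_iff)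
    show "\<one>\<^bsub>rrb_C2 A K\<^esub> \<in> rrb_B2 A K M" using cobounds_one by (auto simp: rrb_B2_iff)
    show "c \<otimes>\<^bsub>rrb_C2 A K\<^esub> d \<in> rrb_B2 A K M" if "c \<in> rrb_B2 A K M" "d \<in> rrb_B2 A K M" for c d
    proof -
      have c: "c \<in> rrb_Z2 A K M" and d: "d \<in> rrb_Z2 A K M" using that by (simp_all add: rrb_B2_iff)
      obtain \<kappa>\<^sub>1 \<kappa>\<^sub>2 \<kappa>\<^sub>1' \<kappa>\<^sub>2' where "cobounds A K M \<kappa>\<^sub>1 \<kappa>\<^sub>2 c" "cobounds A K M \<kappa>\<^sub>1' \<kappa>\<^sub>2' d"
        using \<open>c \<in> rrb_B2 A K M\<close> \<open>d \<in> rrb_B2 A K M\<close> unfolding rrb_B2_iff by blast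
      from cobounds_mult[OF Z2_imp_C2[OF c] Z2_imp_C2[OF d] this] Z2.m_closed[OF c d]
      show ?thesis unfolding rrb_B2_iff by blast
    qed
    show "inv\<^bsub>rrb_C2 A K\<^esub> c \<in> rrb_B2 A K M" if "c \<in> rrb_B2 A K M" for c
    proof -
      have c: "c \<in> rrb_Z2 A K M" using that by (simp add: rrb_B2_iff)
      obtain \<kappa>\<^sub>1 \<kappa>\<^sub>2 where "cobounds A K M \<kappa>\<^sub>1 \<kappa>\<^sub>2 c"
        using \<open>c \<in> rrb_B2 A K M\<close> unfolding rrb_B2_iff by blast
      from cobounds_inv[OF Z2_imp_C2[OF c] this] Z2.m_inv_closed[OF c]
      show ?thesis unfolding rrb_B2_iff by blast
    qed
  qed
qed

text \<open>The quotient of two cocycles is a cocycle, so for it to be a coboundary only the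
  witnesses remain to be found.\<close>

lemma class_eq_iff:
  assumes "c \<in> rrb_Z2 A K M" "d \<in> rrb_Z2 A K M"
  shows "rrb_class A K M c = rrb_class A K M d \<longleftrightarrow>
    (\<exists>\<kappa>\<^sub>1 \<kappa>\<^sub>2. cobounds A K M \<kappa>\<^sub>1 \<kappa>\<^sub>2 (c \<otimes>\<^bsub>rrb_C2 A K\<^esub> inv\<^bsub>rrb_C2 A K\<^esub> d))"
proof -
  interpret Z2: subgroup "rrb_Z2 A K M" "rrb_C2 A K" by (rule subgroup_Z2)
  note B2 = subgroup_B2
  have cd: "c \<in> carrier (rrb_C2 A K)" "d \<in> carrier (rrb_C2 A K)"
    using assms by (simp_all add: Z2_imp_C2)
  have "rrb_class A K M c = rrb_class A K M d \<longleftrightarrow> c \<in> rrb_B2 A K M #>\<^bsub>rrb_C2 A K\<^esub> d"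
    unfolding rrb_class_eq using C2.repr_independence[OF _ cd(2) B2] C2.rcos_self[OF cd(1) B2]
    by blast
  also have "\<dots> \<longleftrightarrow> c \<otimes>\<^bsub>rrb_C2 A K\<^esub> inv\<^bsub>rrb_C2 A K\<^esub> d \<in> rrb_B2 A K M"
    by (rule subgroup.rcos_module[OF B2 C2.is_group cd(2,1)])
  finally have "rrb_class A K M c = rrb_class A K M d \<longleftrightarrow>
      c \<otimes>\<^bsub>rrb_C2 A K\<^esub> inv\<^bsub>rrb_C2 A K\<^esub> d \<in> rrb_B2 A K M" .
  with assms show ?thesis by (simp add: rrb_B2_iff)
qed

end

section \<open>Induced maps on cohomology\<close>

lemma rrb_autoD:
  assumes "\<psi> \<in> rrb_auto X"
  shows "fst \<psi> \<in> auto (rH X)" "snd \<psi> \<in> auto (rG X)"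
    and "h \<in> carrier (rH X) \<Longrightarrow> snd \<psi> (rR X h) = rR X (fst \<psi> h)"
    and "\<lbrakk>g \<in> carrier (rG X); h \<in> carrier (rH X)\<rbrakk> \<Longrightarrow>
      fst \<psi> (rphi X g h) = rphi X (snd \<psi> g) (fst \<psi> h)"
  using assms by (auto simp: rrb_auto_def rrb_hom_def)

lemma twist_action_simps [simp]:
  "act_nu (twist_action \<psi> M) b = act_nu M (snd \<psi> b)"
  "act_mu (twist_action \<psi> M) a = act_mu M (fst \<psi> a)"
  "act_sigma (twist_action \<psi> M) b = act_sigma M (snd \<psi> b)"
  "act_f (twist_action \<psi> M) l a = act_f M l (fst \<psi> a)"
  "nu_inv K (twist_action \<psi> M) b = nu_inv K M (snd \<psi> b)"
  by (simp_all add: twist_action_def nu_inv_def)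

lemma eval_pullback [simp]:
  "\<lbrakk>a \<in> carrier (rH A); a' \<in> carrier (rH A)\<rbrakk> \<Longrightarrow>
    fst (pullback_cochain A \<psi> c) (a, a') = fst c (fst \<psi> a, fst \<psi> a')"
  "\<lbrakk>b \<in> carrier (rG A); b' \<in> carrier (rG A)\<rbrakk> \<Longrightarrow>
    fst (snd (pullback_cochain A \<psi> c)) (b, b') = fst (snd c) (snd \<psi> b, snd \<psi> b')"
  "\<lbrakk>a \<in> carrier (rH A); b \<in> carrier (rG A)\<rbrakk> \<Longrightarrow>
    fst (snd (snd (pullback_cochain A \<psi> c))) (a, b) = fst (snd (snd c)) (fst \<psi> a, snd \<psi> b)"
  "a \<in> carrier (rH A) \<Longrightarrow> snd (snd (snd (pullback_cochain A \<psi> c))) a = snd (snd (snd c)) (fst \<psi> a)"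
  by (simp_all add: pullback_cochain_def split_beta)

lemma eval_pushforward [simp]:
  "\<lbrakk>a \<in> carrier (rH A); a' \<in> carrier (rH A)\<rbrakk> \<Longrightarrow>
    fst (pushforward_cochain A \<theta> c) (a, a') = fst \<theta> (fst c (a, a'))"
  "\<lbrakk>b \<in> carrier (rG A); b' \<in> carrier (rG A)\<rbrakk> \<Longrightarrow>
    fst (snd (pushforward_cochain A \<theta> c)) (b, b') = snd \<theta> (fst (snd c) (b, b'))"
  "\<lbrakk>a \<in> carrier (rH A); b \<in> carrier (rG A)\<rbrakk> \<Longrightarrow>
    fst (snd (snd (pushforward_cochain A \<theta> c))) (a, b) = fst \<theta> (fst (snd (snd c)) (a, b))"
  "a \<in> carrier (rH A) \<Longrightarrow>
    snd (snd (snd (pushforward_cochain A \<theta> c))) a = snd \<theta> (snd (snd (snd c)) a)"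
  by (simp_all add: pushforward_cochain_def split_beta compose_def)

context rrb_module
begin

text \<open>Well-definedness of both starred maps. A multiplicative map sending coboundaries to
  coboundaries keeps a coset inside one coset, so the set of image classes is a singleton, nonempty
  since \<open>c\<close> lies in its own class.\<close>

lemma the_elem_class_image:
  assumes M': "rrb_module A K M'" and c: "c \<in> rrb_Z2 A K M"
    and F_closed: "\<And>c. c \<in> carrier (rrb_C2 A K) \<Longrightarrow> F c \<in> carrier (rrb_C2 A K)"
    and F_mult: "\<And>c d. \<lbrakk>c \<in> carrier (rrb_C2 A K); d \<in> carrier (rrb_C2 A K)\<rbrakk> \<Longrightarrow>
      F (c \<otimes>\<^bsub>rrb_C2 A K\<^esub> d) = F c \<otimes>\<^bsub>rrb_C2 A K\<^esub> F d"
    and F_B2: "\<And>c. c \<in> rrb_B2 A K M \<Longrightarrow> F c \<in> rrb_B2 A K M'"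
  shows "the_elem ((\<lambda>c. rrb_class A K M' (F c)) ` rrb_class A K M c) = rrb_class A K M' (F c)"
proof -
  interpret M': rrb_module A K M' by fact
  note c' = Z2_imp_C2[OF c]
  have "rrb_class A K M' (F x) = rrb_class A K M' (F c)" if "x \<in> rrb_class A K M c" for x
  proof -
    from that obtain b where b: "b \<in> rrb_B2 A K M" "x = b \<otimes>\<^bsub>rrb_C2 A K\<^esub> c"
      by (auto simp: rrb_class_eq r_coset_def)
    then have "b \<in> carrier (rrb_C2 A K)" using subgroup.subset[OF subgroup_B2] by blast
    then have "F x = F b \<otimes>\<^bsub>rrb_C2 A K\<^esub> F c" by (simp add: b F_mult c')
    then have "F x \<in> rrb_B2 A K M' #>\<^bsub>rrb_C2 A K\<^esub> F c"
      using F_B2[OF b(1)] by (auto simp: r_coset_def)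
    then show ?thesis
      unfolding rrb_class_eq using C2.repr_independence[OF _ F_closed[OF c'] M'.subgroup_B2] by blast
  qed
  moreover have "c \<in> rrb_class A K M c"
    unfolding rrb_class_eq by (rule C2.rcos_self[OF c' subgroup_B2])
  ultimately have "(\<lambda>c. rrb_class A K M' (F c)) ` rrb_class A K M c = {rrb_class A K M' (F c)}"
    by blast
  then show ?thesis by simp
qed

lemma rrb_module_twist:
  assumes \<psi>: "\<psi> \<in> rrb_auto A"
  shows "rrb_module A K (twist_action \<psi> M)"
proof -
  have [simp]: "a \<in> carrier (rH A) \<Longrightarrow> fst \<psi> a \<in> carrier (rH A)"
    "b \<in> carrier (rG A) \<Longrightarrow> snd \<psi> b \<in> carrier (rG A)" for a b
    using hom_in_carrier[OF autoD(1)[OF rrb_autoD(1)[OF \<psi>]]]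
      hom_in_carrier[OF autoD(1)[OF rrb_autoD(2)[OF \<psi>]]] by auto
  show ?thesis
    by unfold_locales (simp_all add: S_hom nu_hom nu_bij mu_hom sigma_hom f_hom KH.m_comm KG.m_comm)
qed

section \<open>Pullback along an automorphism of the quotient\<close>

context
  fixes \<psi> assumes \<psi>: "\<psi> \<in> rrb_auto A"
begin

interpretation \<psi>1: group_hom "rH A" "rH A" "fst \<psi>"
  by unfold_locales (rule autoD[OF rrb_autoD(1)[OF \<psi>]])
interpretation \<psi>2: group_hom "rG A" "rG A" "snd \<psi>"
  by unfold_locales (rule autoD[OF rrb_autoD(2)[OF \<psi>]])
interpretation twist: rrb_module A K "twist_action \<psi> M"
  by (rule rrb_module_twist[OF \<psi>])

lemma circ_T_auto:
  "\<lbrakk>a \<in> carrier (rH A); b \<in> carrier (rH A)\<rbrakk> \<Longrightarrow>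
    circ_T A (fst \<psi> a) (fst \<psi> b) = fst \<psi> (circ_T A a b)"
  by (simp add: circ_T_def rrb_autoD[OF \<psi>])

lemma pullback_C2:
  assumes "c \<in> carrier (rrb_C2 A K)"
  shows "pullback_cochain A \<psi> c \<in> carrier (rrb_C2 A K)"
proof -
  have "fst \<psi> \<one>\<^bsub>rH A\<^esub> = \<one>\<^bsub>rH A\<^esub>" "snd \<psi> \<one>\<^bsub>rG A\<^esub> = \<one>\<^bsub>rG A\<^esub>"
    and "\<forall>a \<in> carrier (rH A). fst \<psi> a \<in> carrier (rH A)"
      "\<forall>b \<in> carrier (rG A). snd \<psi> b \<in> carrier (rG A)"
    by simp_all
  then show ?thesis
    using assms by (cases c, cases \<psi>) (auto simp: rrb_C2_def Let_def pullback_cochain_def PiE_iff)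
qed

lemma pullback_mult:
  assumes "c \<in> carrier (rrb_C2 A K)" "d \<in> carrier (rrb_C2 A K)"
  shows "pullback_cochain A \<psi> (c \<otimes>\<^bsub>rrb_C2 A K\<^esub> d) =
    pullback_cochain A \<psi> c \<otimes>\<^bsub>rrb_C2 A K\<^esub> pullback_cochain A \<psi> d"
  using assms by (intro C2_eqI pullback_C2 C2.m_closed) simp_all

lemma pullback_Z2:
  assumes c: "c \<in> rrb_Z2 A K M"
  shows "pullback_cochain A \<psi> c \<in> rrb_Z2 A K (twist_action \<psi> M)"
proof -
  \<comment> \<open>These rules move \<psi> outwards, against the direction of
    \<open>rrb_autoD\<close>, so that the conditions for \<open>c\<close> at \<psi>-images become
    those for the pullback.\<close>
  have [simp]: "rphi A (snd \<psi> b) (fst \<psi> a) = fst \<psi> (rphi A b a)"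
    if "a \<in> carrier (rH A)" "b \<in> carrier (rG A)" for a b
    using that by (simp add: rrb_autoD(4)[OF \<psi>])
  have [simp]: "rR A (fst \<psi> a) = snd \<psi> (rR A a)" if "a \<in> carrier (rH A)" for a
    using that by (simp add: rrb_autoD(3)[OF \<psi>])
  show ?thesis
    unfolding twist.Z2_iff
  proof (intro conjI ballI pullback_C2 Z2_imp_C2 c, goal_cases)
    case (1 a b d)
    then show ?case
      using Z2D(1)[OF c, of "fst \<psi> a" "fst \<psi> b" "fst \<psi> d"]
      by simp
  next
    case (2 a b d)
    then show ?case
      using Z2D(2)[OF c, of "snd \<psi> a" "snd \<psi> b" "snd \<psi> d"]
      by simp
  next
    case (3 a b d)
    then show ?case
      using Z2D(3)[OF c, of "fst \<psi> a" "snd \<psi> b" "snd \<psi> d"]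
      by simp
  next
    case (4 a b d)
    then show ?case
      using Z2D(4)[OF c, of "fst \<psi> a" "fst \<psi> b" "snd \<psi> d"]
      by simp
  next
    case (5 a b)
    then show ?case
      using Z2D(5)[OF c, of "fst \<psi> a" "fst \<psi> b"]
      by (simp add: circ_T_auto)
  qed
qed

lemma pullback_B2:
  assumes c: "c \<in> rrb_B2 A K M"
  shows "pullback_cochain A \<psi> c \<in> rrb_B2 A K (twist_action \<psi> M)"
proof -
  from c obtain \<kappa>\<^sub>1 \<kappa>\<^sub>2 where "c \<in> rrb_Z2 A K M" and "cobounds A K M \<kappa>\<^sub>1 \<kappa>\<^sub>2 c"
    unfolding rrb_B2_iff by blast
  moreover from this(2)
  have "cobounds A K (twist_action \<psi> M) (\<lambda>a. \<kappa>\<^sub>1 (fst \<psi> a)) (\<lambda>b. \<kappa>\<^sub>2 (snd \<psi> b)) (pullback_cochain A \<psi> c)"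
    by (auto simp: cobounds_def rrb_autoD[OF \<psi>])
  ultimately show ?thesis unfolding rrb_B2_iff using pullback_Z2 by blast
qed

lemma psi_star_class:
  assumes "c \<in> rrb_Z2 A K M"
  shows "psi_star A K M \<psi> (rrb_class A K M c) =
    rrb_class A K (twist_action \<psi> M) (pullback_cochain A \<psi> c)"
  unfolding psi_star_def restrict_apply'[OF rrb_class_in_H2[OF assms]]
  by (intro the_elem_class_image twist.rrb_module_axioms assms pullback_C2 pullback_mult pullback_B2)

section \<open>Pushforward along a module isomorphism\<close>

context
  fixes \<theta> assumes \<theta>: "rrb_module_iso A K M (twist_action \<psi> M) \<theta>"
begin

lemma module_iso_auto: "\<theta> \<in> rrb_auto K"
  using \<theta> by (simp add: rrb_module_iso_def)

interpretation \<theta>1: group_hom "rH K" "rH K" "fst \<theta>"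
  by unfold_locales (rule autoD[OF rrb_autoD(1)[OF module_iso_auto]])
interpretation \<theta>2: group_hom "rG K" "rG K" "snd \<theta>"
  by unfold_locales (rule autoD[OF rrb_autoD(2)[OF module_iso_auto]])

lemma module_iso_action:
  shows "\<lbrakk>b \<in> carrier (rG A); k \<in> carrier (rH K)\<rbrakk> \<Longrightarrow>
      fst \<theta> (act_nu M b k) = act_nu M (snd \<psi> b) (fst \<theta> k)"
    and "\<lbrakk>a \<in> carrier (rH A); k \<in> carrier (rH K)\<rbrakk> \<Longrightarrow>
      fst \<theta> (act_mu M a k) = act_mu M (fst \<psi> a) (fst \<theta> k)"
    and "\<lbrakk>b \<in> carrier (rG A); l \<in> carrier (rG K)\<rbrakk> \<Longrightarrow>
      snd \<theta> (act_sigma M b l) = act_sigma M (snd \<psi> b) (snd \<theta> l)"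
    and "\<lbrakk>l \<in> carrier (rG K); a \<in> carrier (rH A)\<rbrakk> \<Longrightarrow>
      fst \<theta> (act_f M l a) = act_f M (snd \<theta> l) (fst \<psi> a)"
  using \<theta> by (simp_all add: rrb_module_iso_def)

lemma module_iso_nu_inv:
  assumes "b \<in> carrier (rG A)" "k \<in> carrier (rH K)"
  shows "fst \<theta> (nu_inv K M b k) = nu_inv K M (snd \<psi> b) (fst \<theta> k)"
  unfolding nu_inv_def
  by (rule bij_betw_conj_inv_into[OF nu_bij nu_bij]) (use assms in \<open>simp_all add: module_iso_action\<close>)

lemmas module_iso_simps =
  module_iso_action module_iso_nu_inv rrb_autoD(3)[OF module_iso_auto]

lemma pushforward_C2:
  assumes "c \<in> carrier (rrb_C2 A K)"
  shows "pushforward_cochain A \<theta> c \<in> carrier (rrb_C2 A K)"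
proof -
  have "fst \<theta> \<one>\<^bsub>rH K\<^esub> = \<one>\<^bsub>rH K\<^esub>" "snd \<theta> \<one>\<^bsub>rG K\<^esub> = \<one>\<^bsub>rG K\<^esub>"
    and "\<forall>k \<in> carrier (rH K). fst \<theta> k \<in> carrier (rH K)"
      "\<forall>l \<in> carrier (rG K). snd \<theta> l \<in> carrier (rG K)"
    by simp_all
  then show ?thesis
    using assms
    by (cases c, cases \<theta>) (auto simp: rrb_C2_def Let_def pushforward_cochain_def PiE_iff compose_def)
qed

lemma pushforward_mult:
  assumes "c \<in> carrier (rrb_C2 A K)" "d \<in> carrier (rrb_C2 A K)"
  shows "pushforward_cochain A \<theta> (c \<otimes>\<^bsub>rrb_C2 A K\<^esub> d) =
    pushforward_cochain A \<theta> c \<otimes>\<^bsub>rrb_C2 A K\<^esub> pushforward_cochain A \<theta> d"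
  using assms by (intro C2_eqI pushforward_C2 C2.m_closed) simp_all

text \<open>Apply \<theta> to each condition for \<open>c\<close>. The intertwining relations
  replace every action map by the one at the \<psi>-image, which is the twisted action; condition
  (v) also uses that \<theta> commutes with S and with the inverse of \<nu>.\<close>

lemma pushforward_Z2:
  assumes c: "c \<in> rrb_Z2 A K M"
  shows "pushforward_cochain A \<theta> c \<in> rrb_Z2 A K (twist_action \<psi> M)"
proof -
  note [simp] = Z2_imp_C2[OF c]
  show ?thesis
    unfolding twist.Z2_iff
  proof (intro conjI ballI pushforward_C2 Z2_imp_C2 c, goal_cases)
    case (1 a b d)
    then show ?case
      using arg_cong[OF Z2D(1)[OF c, of a b d], of "fst \<theta>"]
      by (simp add: module_iso_simps)
  next
    case (2 a b d)
    then show ?case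
      using arg_cong[OF Z2D(2)[OF c, of a b d], of "snd \<theta>"]
      by (simp add: module_iso_simps)
  next
    case (3 a b d)
    then show ?case
      using arg_cong[OF Z2D(3)[OF c, of a b d], of "fst \<theta>"]
      by (simp add: module_iso_simps)
  next
    case (4 a b d)
    then show ?case
      using arg_cong[OF Z2D(4)[OF c, of a b d], of "fst \<theta>"]
      by (simp add: module_iso_simps rrb_autoD[OF \<psi>])
  next
    case (5 a b)
    then show ?case
      using arg_cong[OF Z2D(5)[OF c, of a b], of "snd \<theta>"]
      by (simp add: module_iso_simps rrb_autoD(3)[OF \<psi>])
  qed
qed

lemma pushforward_B2:
  assumes c: "c \<in> rrb_B2 A K M"
  shows "pushforward_cochain A \<theta> c \<in> rrb_B2 A K (twist_action \<psi> M)"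
proof -
  from c obtain \<kappa>\<^sub>1 \<kappa>\<^sub>2 where "c \<in> rrb_Z2 A K M" and "cobounds A K M \<kappa>\<^sub>1 \<kappa>\<^sub>2 c"
    unfolding rrb_B2_iff by blast
  moreover from this(2)
  have "cobounds A K (twist_action \<psi> M) (\<lambda>a. fst \<theta> (\<kappa>\<^sub>1 a)) (\<lambda>b. snd \<theta> (\<kappa>\<^sub>2 b)) (pushforward_cochain A \<theta> c)"
    by (auto simp: cobounds_def Pi_iff module_iso_simps)
  ultimately show ?thesis unfolding rrb_B2_iff using pushforward_Z2 by blast
qed

lemma theta_star_class:
  assumes "c \<in> rrb_Z2 A K M"
  shows "theta_star A K M \<psi> \<theta> (rrb_class A K M c) =
    rrb_class A K (twist_action \<psi> M) (pushforward_cochain A \<theta> c)"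
  unfolding theta_star_def restrict_apply'[OF rrb_class_in_H2[OF assms]]
  by (intro the_elem_class_image twist.rrb_module_axioms assms pushforward_C2 pushforward_mult
      pushforward_B2)

text \<open>Dividing the pushforward by the pullback, and not the other way round, makes the
  witnesses the \<kappa> of a lift and not their inverses. The factors on the right are ordered as
  in \<open>extend_auto\<close>.\<close>

lemma cobounds_quotient_iff:
  assumes "c \<in> rrb_Z2 A K M"
  shows "cobounds A K (twist_action \<psi> M) \<kappa>\<^sub>1 \<kappa>\<^sub>2
      (pushforward_cochain A \<theta> c \<otimes>\<^bsub>rrb_C2 A K\<^esub> inv\<^bsub>rrb_C2 A K\<^esub> pullback_cochain A \<psi> c) \<longleftrightarrow>
    \<kappa>\<^sub>1 \<in> carrier (rH A) \<rightarrow> carrier (rH K) \<and> \<kappa>\<^sub>2 \<in> carrier (rG A) \<rightarrow> carrier (rG K) \<and>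
    \<kappa>\<^sub>1 \<one>\<^bsub>rH A\<^esub> = \<one>\<^bsub>rH K\<^esub> \<and> \<kappa>\<^sub>2 \<one>\<^bsub>rG A\<^esub> = \<one>\<^bsub>rG K\<^esub> \<and>
    (\<forall>a \<in> carrier (rH A). \<forall>b \<in> carrier (rH A).
      \<kappa>\<^sub>1 (a \<otimes>\<^bsub>rH A\<^esub> b) \<otimes>\<^bsub>rH K\<^esub> fst \<theta> (fst c (a, b)) =
      fst c (fst \<psi> a, fst \<psi> b) \<otimes>\<^bsub>rH K\<^esub> act_mu M (fst \<psi> b) (\<kappa>\<^sub>1 a) \<otimes>\<^bsub>rH K\<^esub> \<kappa>\<^sub>1 b) \<and>
    (\<forall>a \<in> carrier (rG A). \<forall>b \<in> carrier (rG A).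
      \<kappa>\<^sub>2 (a \<otimes>\<^bsub>rG A\<^esub> b) \<otimes>\<^bsub>rG K\<^esub> snd \<theta> (fst (snd c) (a, b)) =
      fst (snd c) (snd \<psi> a, snd \<psi> b) \<otimes>\<^bsub>rG K\<^esub> act_sigma M (snd \<psi> b) (\<kappa>\<^sub>2 a) \<otimes>\<^bsub>rG K\<^esub> \<kappa>\<^sub>2 b) \<and>
    (\<forall>a \<in> carrier (rH A). \<forall>b \<in> carrier (rG A).
      \<kappa>\<^sub>1 (rphi A b a) \<otimes>\<^bsub>rH K\<^esub> fst \<theta> (fst (snd (snd c)) (a, b)) =
      fst (snd (snd c)) (fst \<psi> a, snd \<psi> b)
        \<otimes>\<^bsub>rH K\<^esub> act_nu M (snd \<psi> b) (act_f M (\<kappa>\<^sub>2 b) (fst \<psi> a) \<otimes>\<^bsub>rH K\<^esub> \<kappa>\<^sub>1 a)) \<and>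
    (\<forall>a \<in> carrier (rH A).
      \<kappa>\<^sub>2 (rR A a) \<otimes>\<^bsub>rG K\<^esub> snd \<theta> (snd (snd (snd c)) a) =
      snd (snd (snd c)) (fst \<psi> a) \<otimes>\<^bsub>rG K\<^esub> rR K (nu_inv K M (snd \<psi> (rR A a)) (\<kappa>\<^sub>1 a)))"
proof -
  note [simp] = Z2_imp_C2[OF assms] pullback_C2 pushforward_C2
  have KH: "x \<otimes>\<^bsub>rH K\<^esub> inv\<^bsub>rH K\<^esub> y = inv\<^bsub>rH K\<^esub> z \<otimes>\<^bsub>rH K\<^esub> u \<otimes>\<^bsub>rH K\<^esub> v \<longleftrightarrow> z \<otimes>\<^bsub>rH K\<^esub> x = y \<otimes>\<^bsub>rH K\<^esub> v \<otimes>\<^bsub>rH K\<^esub> u"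
    if "x \<in> carrier (rH K)" "y \<in> carrier (rH K)" "z \<in> carrier (rH K)" "u \<in> carrier (rH K)"
      "v \<in> carrier (rH K)" for x y z u v
    using that KH.div_eq_div_iff[of x y z "v \<otimes>\<^bsub>rH K\<^esub> u"] by (simp add: KH.m_ac)
  have KG: "x \<otimes>\<^bsub>rG K\<^esub> inv\<^bsub>rG K\<^esub> y = inv\<^bsub>rG K\<^esub> z \<otimes>\<^bsub>rG K\<^esub> u \<otimes>\<^bsub>rG K\<^esub> v \<longleftrightarrow> z \<otimes>\<^bsub>rG K\<^esub> x = y \<otimes>\<^bsub>rG K\<^esub> v \<otimes>\<^bsub>rG K\<^esub> u"
    if "x \<in> carrier (rG K)" "y \<in> carrier (rG K)" "z \<in> carrier (rG K)" "u \<in> carrier (rG K)"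
      "v \<in> carrier (rG K)" for x y z u v
    using that KG.div_eq_div_iff[of x y z "v \<otimes>\<^bsub>rG K\<^esub> u"] by (simp add: KG.m_ac)
  show ?thesis
    unfolding cobounds_def
    \<comment> \<open>Without \<open>action_mult\<close> the argument of \<nu> in the third family
      stays a single product, as in the statement.\<close>
    by (intro conj_cong refl ball_cong)
      (simp_all add: KH KG KH.div_eq_div_iff KG.div_eq_div_iff Pi_iff del: action_mult)
qed

theorem theta_star_eq_psi_star_iff:
  assumes c: "c \<in> rrb_Z2 A K M"
  shows "theta_star A K M \<psi> \<theta> (rrb_class A K M c) = psi_star A K M \<psi> (rrb_class A K M c) \<longleftrightarrow>
    (\<exists>\<kappa>\<^sub>1 \<kappa>\<^sub>2. cobounds A K (twist_action \<psi> M) \<kappa>\<^sub>1 \<kappa>\<^sub>2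
      (pushforward_cochain A \<theta> c \<otimes>\<^bsub>rrb_C2 A K\<^esub> inv\<^bsub>rrb_C2 A K\<^esub> pullback_cochain A \<psi> c))"
  unfolding theta_star_class[OF c] psi_star_class[OF c]
  by (rule twist.class_eq_iff[OF pushforward_Z2[OF c] pullback_Z2[OF c]])

end

end

end

section \<open>Abelian extensions of relative Rota--Baxter groups\<close>

locale rrb_extension_sections =
  fixes E :: "('k, 'l, 'h, 'g, 'a, 'b) rrb_ext" and sH :: "'a \<Rightarrow> 'h" and sG :: "'b \<Rightarrow> 'g"
  assumes abelian: "abelian_rrb_extension E" and sections: "normalized_sections E sH sG"
begin

abbreviation "A \<equiv> eA E"
abbreviation "K \<equiv> eK E"
abbreviation "H \<equiv> eH E"
abbreviation "M \<equiv> ext_action E sH sG"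
abbreviation "c \<equiv> ext_cocycle E sH sG"

lemma ext: "rrb_extension E"
  using abelian by (simp add: abelian_rrb_extension_def)

lemma groups:
  "comm_group (rH K)" "comm_group (rG K)" "group (rH H)" "group (rG H)" "group (rH A)" "group (rG A)"
  using abelian ext by (simp_all add: abelian_rrb_extension_def rrb_extension_def rrb_group_def)

lemma ext_homs:
  "inc1 E \<in> hom (rH K) (rH H)" "inc2 E \<in> hom (rG K) (rG H)"
  "proj1 E \<in> hom (rH H) (rH A)" "proj2 E \<in> hom (rG H) (rG A)"
  using ext by (simp_all add: rrb_extension_def rrb_hom_def)

text \<open>\<open>X\<close> is the extension of the first components and \<open>Y\<close> that of
  the second; \<open>X.conjugate\<close>, \<open>X.coc\<close> stand for \<mu> and the first cocycle
  component, \<open>Y.conjugate\<close>, \<open>Y.coc\<close> for \<sigma> and the second.\<close>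

sublocale X: abelian_extension "rH K" "rH H" "rH A" "inc1 E" "proj1 E" sH
  unfolding abelian_extension_def group_hom_def group_hom_axioms_def abelian_extension_axioms_def
  using ext sections
  by (auto simp: groups ext_homs comm_group.axioms rrb_extension_def normalized_sections_def)

sublocale Y: abelian_extension "rG K" "rG H" "rG A" "inc2 E" "proj2 E" sG
  unfolding abelian_extension_def group_hom_def group_hom_axioms_def abelian_extension_axioms_def
  using ext sections
  by (auto simp: groups ext_homs comm_group.axioms rrb_extension_def normalized_sections_def)

lemma ret_eq: "ret1 E = X.ret" "ret2 E = Y.ret"
  by (simp_all add: ret1_def ret2_def X.ret_def Y.ret_def)

section \<open>The structure maps of the three relative Rota--Baxter groups\<close>

lemma phi_auto:
  assumes "g \<in> carrier (rG H)"
  shows "rphi H g \<in> auto (rH H)"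
proof -
  have "rphi H \<in> hom (rG H) (AutoGroup (rH H))"
    using ext by (simp add: rrb_extension_def rrb_group_def)
  from hom_in_carrier[OF this assms] show ?thesis by (simp add: AutoGroup_def)
qed

lemma phi_closed_H [simp]:
  "\<lbrakk>g \<in> carrier (rG H); h \<in> carrier (rH H)\<rbrakk> \<Longrightarrow> rphi H g h \<in> carrier (rH H)"
  using hom_in_carrier[OF autoD(1)[OF phi_auto]] by blast

lemma phi_mult [simp]:
  "\<lbrakk>g \<in> carrier (rG H); h \<in> carrier (rH H); h' \<in> carrier (rH H)\<rbrakk> \<Longrightarrow>
    rphi H g (h \<otimes>\<^bsub>rH H\<^esub> h') = rphi H g h \<otimes>\<^bsub>rH H\<^esub> rphi H g h'"
  using hom_mult[OF autoD(1)[OF phi_auto]] by blast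

lemma phi_comp:
  assumes "g \<in> carrier (rG H)" "g' \<in> carrier (rG H)" "h \<in> carrier (rH H)"
  shows "rphi H (g \<otimes>\<^bsub>rG H\<^esub> g') h = rphi H g (rphi H g' h)"
proof -
  have "rphi H \<in> hom (rG H) (AutoGroup (rH H))"
    using ext by (simp add: rrb_extension_def rrb_group_def)
  from hom_mult[OF this assms(1,2)]
  have "rphi H (g \<otimes>\<^bsub>rG H\<^esub> g') = compose (carrier (rH H)) (rphi H g) (rphi H g')"
    using phi_auto[OF assms(1)] phi_auto[OF assms(2)]
    by (simp add: AutoGroup_def BijGroup_def auto_def)
  then show ?thesis using assms(3) by (simp add: compose_def)
qed

lemma phi_one:
  assumes "h \<in> carrier (rH H)"
  shows "rphi H \<one>\<^bsub>rG H\<^esub> h = h"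
proof -
  have "rphi H \<in> hom (rG H) (AutoGroup (rH H))"
    using ext by (simp add: rrb_extension_def rrb_group_def)
  from hom_one[OF this Y.incl.H.is_group X.incl.H.AutoGroup] show ?thesis
    using assms by (simp add: AutoGroup_def BijGroup_def)
qed

lemma phi_group_one [simp]:
  "g \<in> carrier (rG H) \<Longrightarrow> rphi H g \<one>\<^bsub>rH H\<^esub> = \<one>\<^bsub>rH H\<^esub>"
  using hom_one[OF autoD(1)[OF phi_auto]] X.incl.H.is_group by blast

lemma R_closed_H [simp]: "h \<in> carrier (rH H) \<Longrightarrow> rR H h \<in> carrier (rG H)"
  using ext by (auto simp: rrb_extension_def rrb_group_def)

lemma R_mult:
  "\<lbrakk>h \<in> carrier (rH H); h' \<in> carrier (rH H)\<rbrakk> \<Longrightarrow>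
    rR H (h \<otimes>\<^bsub>rH H\<^esub> rphi H (rR H h) h') = rR H h \<otimes>\<^bsub>rG H\<^esub> rR H h'"
  using ext by (simp add: rrb_extension_def rrb_group_def)

lemma A_phi_closed [simp]:
  assumes "b \<in> carrier (rG A)" "a \<in> carrier (rH A)"
  shows "rphi A b a \<in> carrier (rH A)"
proof -
  have "rphi A \<in> hom (rG A) (AutoGroup (rH A))"
    using ext by (simp add: rrb_extension_def rrb_group_def)
  from hom_in_carrier[OF this assms(1)] have "rphi A b \<in> hom (rH A) (rH A)"
    by (simp add: AutoGroup_def auto_def)
  then show ?thesis using hom_in_carrier assms(2) by metis
qed

lemma A_R_closed [simp]: "a \<in> carrier (rH A) \<Longrightarrow> rR A a \<in> carrier (rG A)"
  using ext by (auto simp: rrb_extension_def rrb_group_def)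

lemma proj_phi [simp]:
  "\<lbrakk>g \<in> carrier (rG H); h \<in> carrier (rH H)\<rbrakk> \<Longrightarrow>
    proj1 E (rphi H g h) = rphi A (proj2 E g) (proj1 E h)"
  using ext by (simp add: rrb_extension_def rrb_hom_def)

lemma proj_R [simp]: "h \<in> carrier (rH H) \<Longrightarrow> proj2 E (rR H h) = rR A (proj1 E h)"
  using ext by (simp add: rrb_extension_def rrb_hom_def)

lemma A_phi_group_one [simp]:
  assumes "b \<in> carrier (rG A)"
  shows "rphi A b \<one>\<^bsub>rH A\<^esub> = \<one>\<^bsub>rH A\<^esub>"
  using proj_phi[of "sG b" "\<one>\<^bsub>rH H\<^esub>"] assms by (simp del: proj_phi)

lemma A_phi_one [simp]:
  assumes "a \<in> carrier (rH A)"
  shows "rphi A \<one>\<^bsub>rG A\<^esub> a = a"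
  using proj_phi[of "\<one>\<^bsub>rG H\<^esub>" "sH a"] assms by (simp add: phi_one del: proj_phi)

lemma A_R_circ:
  "\<lbrakk>a \<in> carrier (rH A); a' \<in> carrier (rH A)\<rbrakk> \<Longrightarrow>
    rR A (circ_T A a a') = rR A a \<otimes>\<^bsub>rG A\<^esub> rR A a'"
  using ext by (simp add: rrb_extension_def rrb_group_def circ_T_def)

lemma K_phi:
  assumes "l \<in> carrier (rG K)" "k \<in> carrier (rH K)"
  shows "rphi K l k = k"
  using abelian assms
  by (simp add: abelian_rrb_extension_def rrb_trivial_def trivial_homomorphism_def AutoGroup_def
      BijGroup_def)

lemma S_closed [simp]: "k \<in> carrier (rH K) \<Longrightarrow> rR K k \<in> carrier (rG K)"
  using ext by (auto simp: rrb_extension_def rrb_group_def)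

text \<open>With trivial \<alpha> the Rota--Baxter identity of S reduces to
  multiplicativity.\<close>

lemma S_mult [simp]:
  assumes "k \<in> carrier (rH K)" "k' \<in> carrier (rH K)"
  shows "rR K (k \<otimes>\<^bsub>rH K\<^esub> k') = rR K k \<otimes>\<^bsub>rG K\<^esub> rR K k'"
  using ext assms by (simp add: rrb_extension_def rrb_group_def K_phi)

lemma R_incl: "k \<in> carrier (rH K) \<Longrightarrow> rR H (inc1 E k) = inc2 E (rR K k)"
  using ext by (simp add: rrb_extension_def rrb_hom_def)

text \<open>Triviality of \<alpha> inside H: L fixes K pointwise. Hence an element of G over b acts
  on K as \<nu> at b, and L acts on s_H(a) k only through f.\<close>

lemma phi_incl_incl:
  assumes "l \<in> carrier (rG K)" "k \<in> carrier (rH K)"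
  shows "rphi H (inc2 E l) (inc1 E k) = inc1 E k"
proof -
  have "inc1 E (rphi K l k) = rphi H (inc2 E l) (inc1 E k)"
    using ext assms by (simp add: rrb_extension_def rrb_hom_def)
  then show ?thesis using assms by (simp add: K_phi)
qed

section \<open>The action, the cocycle and the structure maps in normal forms\<close>

lemma act_mu_eq: "k \<in> carrier (rH K) \<Longrightarrow> act_mu M a k = X.conjugate a k"
  by (simp add: ext_action_def X.conjugate_def ret_eq Let_def)

lemma act_sigma_eq: "l \<in> carrier (rG K) \<Longrightarrow> act_sigma M b l = Y.conjugate b l"
  by (simp add: ext_action_def Y.conjugate_def ret_eq Let_def)

lemma act_nu_eq: "k \<in> carrier (rH K) \<Longrightarrow> act_nu M b k = X.ret (rphi H (sG b) (inc1 E k))"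
  by (simp add: ext_action_def ret_eq Let_def)

lemma
  assumes "b \<in> carrier (rG A)" "k \<in> carrier (rH K)"
  shows act_nu_closed [simp]: "act_nu M b k \<in> carrier (rH K)"
    and phi_section_incl: "rphi H (sG b) (inc1 E k) = inc1 E (act_nu M b k)"
  using assms X.incl_ret[of "rphi H (sG b) (inc1 E k)"] X.ret_closed[of "rphi H (sG b) (inc1 E k)"]
  by (simp_all add: act_nu_eq)

lemma
  assumes "l \<in> carrier (rG K)" "a \<in> carrier (rH A)"
  shows act_f_closed [simp]: "act_f M l a \<in> carrier (rH K)"
    and phi_incl_section: "rphi H (inc2 E l) (sH a) = X.elt a (act_f M l a)"
proof -
  let ?x = "rphi H (inc2 E l) (sH a)"
  have "act_f M l a = X.part ?x"
    using assms by (simp add: ext_action_def Let_def ret_eq X.ret_inv_section_mult)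
  then show "act_f M l a \<in> carrier (rH K)" "?x = X.elt a (act_f M l a)"
    using assms X.elt_proj_part[of ?x] by simp_all
qed

definition "rho a b = X.part (rphi H (sG b) (sH a))"
definition "chi a = Y.part (rR H (sH a))"

lemma ext_cocycle_eval:
  "\<lbrakk>a \<in> carrier (rH A); a' \<in> carrier (rH A)\<rbrakk> \<Longrightarrow> fst c (a, a') = X.coc a a'"
  "\<lbrakk>b \<in> carrier (rG A); b' \<in> carrier (rG A)\<rbrakk> \<Longrightarrow> fst (snd c) (b, b') = Y.coc b b'"
  "\<lbrakk>a \<in> carrier (rH A); b \<in> carrier (rG A)\<rbrakk> \<Longrightarrow> fst (snd (snd c)) (a, b) = rho a b"
  "a \<in> carrier (rH A) \<Longrightarrow> snd (snd (snd c)) a = chi a"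
  by (simp_all add: ext_cocycle_def Let_def ret_eq X.coc_def Y.coc_def rho_def chi_def
      X.ret_inv_section_mult Y.ret_inv_section_mult)

lemma rho_closed [simp]: "\<lbrakk>a \<in> carrier (rH A); b \<in> carrier (rG A)\<rbrakk> \<Longrightarrow> rho a b \<in> carrier (rH K)"
  by (simp add: rho_def)

lemma chi_closed [simp]: "a \<in> carrier (rH A) \<Longrightarrow> chi a \<in> carrier (rG K)"
  by (simp add: chi_def)

lemma phi_section_section:
  assumes "a \<in> carrier (rH A)" "b \<in> carrier (rG A)"
  shows "rphi H (sG b) (sH a) = X.elt (rphi A b a) (rho a b)"
  using assms X.elt_proj_part[of "rphi H (sG b) (sH a)"] by (simp add: rho_def)

lemma R_section:
  assumes "a \<in> carrier (rH A)"
  shows "rR H (sH a) = Y.elt (rR A a) (chi a)"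
  using assms Y.elt_proj_part[of "rR H (sH a)"] by (simp add: chi_def)

lemma phi_incl_elt:
  assumes "a \<in> carrier (rH A)" "k \<in> carrier (rH K)" "l \<in> carrier (rG K)"
  shows "rphi H (inc2 E l) (X.elt a k) = X.elt a (act_f M l a \<otimes>\<^bsub>rH K\<^esub> k)"
proof -
  have "rphi H (inc2 E l) (X.elt a k) = X.elt a (act_f M l a) \<otimes>\<^bsub>rH H\<^esub> inc1 E k"
    using assms by (simp add: X.elt_def[of a k] phi_incl_section phi_incl_incl)
  then show ?thesis using assms by (simp add: X.elt_mult_incl)
qed

lemma phi_section_elt:
  assumes "a \<in> carrier (rH A)" "k \<in> carrier (rH K)" "b \<in> carrier (rG A)"
  shows "rphi H (sG b) (X.elt a k) = X.elt (rphi A b a) (rho a b \<otimes>\<^bsub>rH K\<^esub> act_nu M b k)"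
proof -
  have "rphi H (sG b) (X.elt a k) = X.elt (rphi A b a) (rho a b) \<otimes>\<^bsub>rH H\<^esub> inc1 E (act_nu M b k)"
    using assms by (simp add: X.elt_def[of a k] phi_section_section phi_section_incl)
  then show ?thesis using assms by (simp add: X.elt_mult_incl)
qed

text \<open>In \<open>Y.elt b l\<close> the factor from L stands on the right and acts first,
  through f; the section value acts next, through \<rho> and \<nu>. This is why \<nu> is applied to
  the value of f.\<close>

lemma phi_elt:
  assumes "a \<in> carrier (rH A)" "k \<in> carrier (rH K)" "b \<in> carrier (rG A)" "l \<in> carrier (rG K)"
  shows "rphi H (Y.elt b l) (X.elt a k) =
    X.elt (rphi A b a) (rho a b \<otimes>\<^bsub>rH K\<^esub> act_nu M b (act_f M l a \<otimes>\<^bsub>rH K\<^esub> k))"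
  unfolding Y.elt_def using assms by (simp add: phi_comp phi_incl_elt phi_section_elt)

lemma phi_elt_incl:
  assumes "k \<in> carrier (rH K)" "b \<in> carrier (rG A)" "l \<in> carrier (rG K)"
  shows "rphi H (Y.elt b l) (inc1 E k) = inc1 E (act_nu M b k)"
  unfolding Y.elt_def using assms by (simp add: phi_comp phi_incl_incl phi_section_incl)

lemma act_nu_mult:
  assumes "b \<in> carrier (rG A)" "k \<in> carrier (rH K)" "k' \<in> carrier (rH K)"
  shows "act_nu M b (k \<otimes>\<^bsub>rH K\<^esub> k') = act_nu M b k \<otimes>\<^bsub>rH K\<^esub> act_nu M b k'"
proof -
  have "inc1 E (act_nu M b (k \<otimes>\<^bsub>rH K\<^esub> k')) = inc1 E (act_nu M b k \<otimes>\<^bsub>rH K\<^esub> act_nu M b k')"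
    using assms by (simp flip: phi_section_incl)
  then show ?thesis by (rule inj_onD[OF X.inj_incl]) (simp_all add: assms)
qed

lemma act_nu_bij:
  assumes b: "b \<in> carrier (rG A)"
  shows "bij_betw (act_nu M b) (carrier (rH K)) (carrier (rH K))"
  unfolding bij_betw_def
proof
  show "inj_on (act_nu M b) (carrier (rH K))"
  proof (rule inj_onI)
    fix k k' assume k: "k \<in> carrier (rH K)" "k' \<in> carrier (rH K)" "act_nu M b k = act_nu M b k'"
    then have "rphi H (sG b) (inc1 E k) = rphi H (sG b) (inc1 E k')"
      using b by (simp add: phi_section_incl)
    then have "inc1 E k = inc1 E k'"
      using bij_betw_imp_inj_on[OF autoD(2)[OF phi_auto[of "sG b"]]] b k by (simp add: inj_on_eq_iff)
    then show "k = k'" using X.inj_incl k by (simp add: inj_on_eq_iff)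
  qed
  have "\<exists>k' \<in> carrier (rH K). act_nu M b k' = k" if k: "k \<in> carrier (rH K)" for k
  proof -
    \<comment> \<open>The inverse of s_G(b) moves the kernel element within the kernel, because the
      projection turns its action into one on the identity of A.\<close>
    let ?x = "rphi H (inv\<^bsub>rG H\<^esub> sG b) (inc1 E k)"
    have x: "inc1 E (X.ret ?x) = ?x" "X.ret ?x \<in> carrier (rH K)"
      using b k by (simp_all add: X.incl_ret X.ret_closed)
    have "rphi H (sG b) ?x = inc1 E k"
      using phi_comp[of "sG b" "inv\<^bsub>rG H\<^esub> sG b" "inc1 E k"] b k by (simp add: phi_one)
    then have "act_nu M b (X.ret ?x) = k" using k x by (simp add: act_nu_eq)
    then show ?thesis using x by blast
  qed
  then show "act_nu M b ` carrier (rH K) = carrier (rH K)" using b by force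
qed

text \<open>Acting by \<open>l'\<close> and then by \<open>l\<close>: the factor f(l', a) lies in K,
  which \<open>l\<close> fixes, so the two values of f multiply.\<close>

lemma act_f_mult:
  assumes "a \<in> carrier (rH A)" "l \<in> carrier (rG K)" "l' \<in> carrier (rG K)"
  shows "act_f M (l \<otimes>\<^bsub>rG K\<^esub> l') a = act_f M l a \<otimes>\<^bsub>rH K\<^esub> act_f M l' a"
proof -
  have "X.elt a (act_f M (l \<otimes>\<^bsub>rG K\<^esub> l') a) = rphi H (inc2 E l) (rphi H (inc2 E l') (sH a))"
    using assms by (simp add: phi_comp flip: phi_incl_section)
  also have "\<dots> = X.elt a (act_f M l a \<otimes>\<^bsub>rH K\<^esub> act_f M l' a)"
    using assms by (simp add: phi_incl_section phi_incl_elt)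
  finally show ?thesis using assms by simp
qed

text \<open>Makes the comparison of classes available for K and, through
  \<open>rrb_module_twist\<close>, for the twisted module.\<close>

sublocale rrb_module A K M
proof
  show "act_mu M a \<in> hom (rH K) (rH K)" if "a \<in> carrier (rH A)" for a
    using that by (simp add: hom_def act_mu_eq X.conjugate_mult)
  show "act_sigma M b \<in> hom (rG K) (rG K)" if "b \<in> carrier (rG A)" for b
    using that by (simp add: hom_def act_sigma_eq Y.conjugate_mult)
qed (auto simp: groups hom_def act_nu_mult act_nu_bij act_f_mult)

text \<open>The Rota--Baxter identity applied to s_H(a) and k' yields R of s_H(a) times the
  \<phi>-image of k'. To obtain s_H(a) k one has to start from the \<nu>-preimage k' of k.\<close>

lemma R_elt:
  assumes "a \<in> carrier (rH A)" "k \<in> carrier (rH K)"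
  shows "rR H (X.elt a k) = Y.elt (rR A a) (chi a \<otimes>\<^bsub>rG K\<^esub> rR K (nu_inv K M (rR A a) k))"
proof -
  let ?k = "nu_inv K M (rR A a) k"
  \<comment> \<open>R(s_H(a)) lies over T(a), and its factor \<chi>(a) from L fixes K, so on K it
    acts as \<nu> at T(a).\<close>
  have "rphi H (rR H (sH a)) (inc1 E ?k) = inc1 E k"
    using assms by (simp add: R_section phi_elt_incl)
  then have "rR H (X.elt a k) = rR H (sH a) \<otimes>\<^bsub>rG H\<^esub> rR H (inc1 E ?k)"
    using R_mult[of "sH a" "inc1 E ?k"] assms by (simp add: X.elt_def)
  then show ?thesis using assms by (simp add: R_section R_incl Y.elt_mult_incl)
qed

lemma rho_one [simp]:
  "b \<in> carrier (rG A) \<Longrightarrow> rho \<one>\<^bsub>rH A\<^esub> b = \<one>\<^bsub>rH K\<^esub>"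
  "a \<in> carrier (rH A) \<Longrightarrow> rho a \<one>\<^bsub>rG A\<^esub> = \<one>\<^bsub>rH K\<^esub>"
  using X.part_elt[of "\<one>\<^bsub>rH A\<^esub>" "\<one>\<^bsub>rH K\<^esub>"] X.part_elt[of a "\<one>\<^bsub>rH K\<^esub>"]
  by (simp_all add: rho_def phi_one del: X.part_elt)

lemma R_one [simp]: "rR H \<one>\<^bsub>rH H\<^esub> = \<one>\<^bsub>rG H\<^esub>"
  using R_incl[of "\<one>\<^bsub>rH K\<^esub>"] by simp

lemma chi_one [simp]: "chi \<one>\<^bsub>rH A\<^esub> = \<one>\<^bsub>rG K\<^esub>"
  using Y.part_elt[of "\<one>\<^bsub>rG A\<^esub>" "\<one>\<^bsub>rG K\<^esub>"]
  by (simp add: chi_def del: Y.part_elt)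

lemma ext_cocycle_C2: "c \<in> carrier (rrb_C2 A K)"
proof -
  have "fst c \<in> carrier (rH A) \<times> carrier (rH A) \<rightarrow>\<^sub>E carrier (rH K)"
    "fst (snd c) \<in> carrier (rG A) \<times> carrier (rG A) \<rightarrow>\<^sub>E carrier (rG K)"
    "fst (snd (snd c)) \<in> carrier (rH A) \<times> carrier (rG A) \<rightarrow>\<^sub>E carrier (rH K)"
    "snd (snd (snd c)) \<in> carrier (rH A) \<rightarrow>\<^sub>E carrier (rG K)"
    using ext_cocycle_eval by (auto simp: PiE_iff) (auto simp: ext_cocycle_def Let_def)
  moreover obtain t1 t2 r x where "c = (t1, t2, r, x)" by (metis prod.collapse)
  ultimately show ?thesis
    using ext_cocycle_eval by (simp add: rrb_C2_def Let_def)
qed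

text \<open>Condition (iii): act on s_H(a) by s_G(b') and then by s_G(b), or at once by the normal
  form of s_G(b) s_G(b').\<close>

lemma rho_comp:
  assumes "a \<in> carrier (rH A)" "b \<in> carrier (rG A)" "b' \<in> carrier (rG A)"
  shows "rho (rphi A b' a) b \<otimes>\<^bsub>rH K\<^esub> act_nu M b (rho a b') =
    rho a (b \<otimes>\<^bsub>rG A\<^esub> b') \<otimes>\<^bsub>rH K\<^esub> act_nu M (b \<otimes>\<^bsub>rG A\<^esub> b') (act_f M (Y.coc b b') a)"
proof -
  have "rphi H (sG b) (rphi H (sG b') (sH a)) = rphi H (Y.elt (b \<otimes>\<^bsub>rG A\<^esub> b') (Y.coc b b')) (X.elt a \<one>\<^bsub>rH K\<^esub>)"
    using assms by (simp flip: phi_comp Y.section_mult)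
  then show ?thesis
    using assms by (simp add: phi_section_section phi_section_elt phi_elt del: X.elt_one)
qed

text \<open>Condition (iv): s_G(b) acts on the product s_H(a) s_H(a') by an automorphism.\<close>

lemma rho_mult:
  assumes "a \<in> carrier (rH A)" "a' \<in> carrier (rH A)" "b \<in> carrier (rG A)"
  shows "rho (a \<otimes>\<^bsub>rH A\<^esub> a') b \<otimes>\<^bsub>rH K\<^esub> act_nu M b (X.coc a a') =
    X.conjugate (rphi A b a') (rho a b) \<otimes>\<^bsub>rH K\<^esub> rho a' b \<otimes>\<^bsub>rH K\<^esub> X.coc (rphi A b a) (rphi A b a')"
proof -
  have "rphi H (sG b) (X.elt (a \<otimes>\<^bsub>rH A\<^esub> a') (X.coc a a')) =
      rphi H (sG b) (sH a) \<otimes>\<^bsub>rH H\<^esub> rphi H (sG b) (sH a')"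
    using assms by (simp flip: X.section_mult)
  then show ?thesis
    using assms by (simp add: phi_section_section phi_section_elt X.elt_mult X.K.m_ac)
qed

text \<open>Condition (v): the Rota--Baxter identity for s_H(a) and s_H(a'), with both sides brought
  to normal form over T of the circle product.\<close>

lemma chi_circ:
  assumes "a \<in> carrier (rH A)" "a' \<in> carrier (rH A)"
  shows "Y.coc (rR A a) (rR A a') \<otimes>\<^bsub>rG K\<^esub> chi a' \<otimes>\<^bsub>rG K\<^esub> inv\<^bsub>rG K\<^esub> (chi (circ_T A a a'))
      \<otimes>\<^bsub>rG K\<^esub> Y.conjugate (rR A a') (chi a) =
    rR K (nu_inv K M (rR A (circ_T A a a')) (rho a' (rR A a)
      \<otimes>\<^bsub>rH K\<^esub> X.coc a (rphi A (rR A a) a') \<otimes>\<^bsub>rH K\<^esub> act_nu M (rR A a) (act_f M (chi a) a')))"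
    (is "?l = rR K (nu_inv K M _ ?k)")
proof -
  \<comment> \<open>The kernel coordinate of R(s_H(a)) R(s_H(a')) as given by
    \<open>elt_mult\<close>; \<open>?l\<close> is this element divided by \<chi> at the circle
    product.\<close>
  let ?u = "Y.coc (rR A a) (rR A a') \<otimes>\<^bsub>rG K\<^esub> Y.conjugate (rR A a') (chi a) \<otimes>\<^bsub>rG K\<^esub> chi a'"
  have "Y.elt (rR A (circ_T A a a')) ?u = rR H (sH a) \<otimes>\<^bsub>rG H\<^esub> rR H (sH a')"
    using assms by (simp add: R_section Y.elt_mult A_R_circ)
  also have "\<dots> = rR H (sH a \<otimes>\<^bsub>rH H\<^esub> rphi H (rR H (sH a)) (sH a'))"
    using assms by (simp add: R_mult)
  also have "sH a \<otimes>\<^bsub>rH H\<^esub> rphi H (rR H (sH a)) (sH a') = X.elt (circ_T A a a') ?k"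
    using assms phi_elt[of a' "\<one>\<^bsub>rH K\<^esub>" "rR A a" "chi a"]
      X.elt_mult[of a "\<one>\<^bsub>rH K\<^esub>" "rphi A (rR A a) a'"
        "rho a' (rR A a) \<otimes>\<^bsub>rH K\<^esub> act_nu M (rR A a) (act_f M (chi a) a')"]
    by (simp add: R_section circ_T_def X.K.m_ac)
  also have "rR H \<dots> = Y.elt (rR A (circ_T A a a'))
      (chi (circ_T A a a') \<otimes>\<^bsub>rG K\<^esub> rR K (nu_inv K M (rR A (circ_T A a a')) ?k))"
    using assms by (intro R_elt) simp_all
  finally have *: "?u = chi (circ_T A a a') \<otimes>\<^bsub>rG K\<^esub> rR K (nu_inv K M (rR A (circ_T A a a')) ?k)"
    using assms by simp
  have "?l = ?u \<otimes>\<^bsub>rG K\<^esub> inv\<^bsub>rG K\<^esub> (chi (circ_T A a a'))"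
    using assms by (simp add: Y.K.m_ac)
  also have "\<dots> = rR K (nu_inv K M (rR A (circ_T A a a')) ?k)"
    unfolding * using assms
    by (subst Y.K.m_comm) (simp_all del: action_mult S_mult S.hom_mult flip: Y.K.m_assoc)
  finally show ?thesis .
qed

lemma ext_cocycle_Z2: "c \<in> rrb_Z2 A K M"
  unfolding Z2_iff
  \<comment> \<open>Distribution of S and of the inverse of \<nu> over products is switched off to
    keep condition (v) in the shape of \<open>chi_circ\<close>.\<close>
  by (intro conjI ballI ext_cocycle_C2)
    (simp_all add: ext_cocycle_eval act_mu_eq act_sigma_eq X.coc_cocycle Y.coc_cocycle rho_comp
      rho_mult chi_circ del: action_mult S_mult S.hom_mult)

text \<open>The relations on \<open>(\<kappa>\<^sub>1, \<kappa>\<^sub>2)\<close> under which \<open>s\<^sub>H(a) k \<mapsto> s\<^sub>H(\<psi>\<^sub>1(a)) \<kappa>\<^sub>1(a) \<theta>\<^sub>1(k)\<close> and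
  \<open>s\<^sub>G(b) l \<mapsto> s\<^sub>G(\<psi>\<^sub>2(b)) \<kappa>\<^sub>2(b) \<theta>\<^sub>2(l)\<close> form an endomorphism, given that \<open>\<theta>\<close> is a module
  isomorphism; they are the coboundary equations cleared of inverses.\<close>

definition lifting_cochain ::
    "('a \<Rightarrow> 'a) \<times> ('b \<Rightarrow> 'b) \<Rightarrow> ('k \<Rightarrow> 'k) \<times> ('l \<Rightarrow> 'l) \<Rightarrow> ('a \<Rightarrow> 'k) \<Rightarrow> ('b \<Rightarrow> 'l) \<Rightarrow> bool" where
  "lifting_cochain \<psi> \<theta> \<kappa>\<^sub>1 \<kappa>\<^sub>2 \<longleftrightarrow>
    \<kappa>\<^sub>1 \<in> carrier (rH A) \<rightarrow> carrier (rH K) \<and> \<kappa>\<^sub>2 \<in> carrier (rG A) \<rightarrow> carrier (rG K) \<and>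
    \<kappa>\<^sub>1 \<one>\<^bsub>rH A\<^esub> = \<one>\<^bsub>rH K\<^esub> \<and> \<kappa>\<^sub>2 \<one>\<^bsub>rG A\<^esub> = \<one>\<^bsub>rG K\<^esub> \<and>
    (\<forall>a \<in> carrier (rH A). \<forall>b \<in> carrier (rH A).
      \<kappa>\<^sub>1 (a \<otimes>\<^bsub>rH A\<^esub> b) \<otimes>\<^bsub>rH K\<^esub> fst \<theta> (X.coc a b) =
      X.coc (fst \<psi> a) (fst \<psi> b) \<otimes>\<^bsub>rH K\<^esub> X.conjugate (fst \<psi> b) (\<kappa>\<^sub>1 a) \<otimes>\<^bsub>rH K\<^esub> \<kappa>\<^sub>1 b) \<and>
    (\<forall>a \<in> carrier (rG A). \<forall>b \<in> carrier (rG A).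
      \<kappa>\<^sub>2 (a \<otimes>\<^bsub>rG A\<^esub> b) \<otimes>\<^bsub>rG K\<^esub> snd \<theta> (Y.coc a b) =
      Y.coc (snd \<psi> a) (snd \<psi> b) \<otimes>\<^bsub>rG K\<^esub> Y.conjugate (snd \<psi> b) (\<kappa>\<^sub>2 a) \<otimes>\<^bsub>rG K\<^esub> \<kappa>\<^sub>2 b) \<and>
    (\<forall>a \<in> carrier (rH A). \<forall>b \<in> carrier (rG A).
      \<kappa>\<^sub>1 (rphi A b a) \<otimes>\<^bsub>rH K\<^esub> fst \<theta> (rho a b) = rho (fst \<psi> a) (snd \<psi> b)
        \<otimes>\<^bsub>rH K\<^esub> act_nu M (snd \<psi> b) (act_f M (\<kappa>\<^sub>2 b) (fst \<psi> a) \<otimes>\<^bsub>rH K\<^esub> \<kappa>\<^sub>1 a)) \<and>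
    (\<forall>a \<in> carrier (rH A). \<kappa>\<^sub>2 (rR A a) \<otimes>\<^bsub>rG K\<^esub> snd \<theta> (chi a) =
      chi (fst \<psi> a) \<otimes>\<^bsub>rG K\<^esub> rR K (nu_inv K M (snd \<psi> (rR A a)) (\<kappa>\<^sub>1 a)))"

section \<open>Inducible pairs and lifting cochains\<close>

context
  fixes \<psi> \<theta> assumes \<psi>: "\<psi> \<in> rrb_auto A" and \<theta>: "\<theta> \<in> rrb_auto K"
begin

interpretation \<psi>1: group_hom "rH A" "rH A" "fst \<psi>"
  by unfold_locales (rule autoD[OF rrb_autoD(1)[OF \<psi>]])
interpretation \<psi>2: group_hom "rG A" "rG A" "snd \<psi>"
  by unfold_locales (rule autoD[OF rrb_autoD(2)[OF \<psi>]])
interpretation \<theta>1: group_hom "rH K" "rH K" "fst \<theta>"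
  by unfold_locales (rule autoD[OF rrb_autoD(1)[OF \<theta>]])
interpretation \<theta>2: group_hom "rG K" "rG K" "snd \<theta>"
  by unfold_locales (rule autoD[OF rrb_autoD(2)[OF \<theta>]])

lemma star_eq_iff_lifting_cochain:
  assumes iso: "rrb_module_iso A K M (twist_action \<psi> M) \<theta>"
  shows "theta_star A K M \<psi> \<theta> (ext_class E sH sG) = psi_star A K M \<psi> (ext_class E sH sG) \<longleftrightarrow>
    (\<exists>\<kappa>\<^sub>1 \<kappa>\<^sub>2. lifting_cochain \<psi> \<theta> \<kappa>\<^sub>1 \<kappa>\<^sub>2)"
  unfolding ext_class_def theta_star_eq_psi_star_iff[OF \<psi> iso ext_cocycle_Z2]
    cobounds_quotient_iff[OF \<psi> iso ext_cocycle_Z2] lifting_cochain_def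
  by (intro iff_exI conj_cong refl ball_cong)
    (simp_all add: ext_cocycle_eval act_mu_eq act_sigma_eq Pi_iff)

text \<open>Each datum is isolated by one instance of compatibility with \<phi>: s_G(b) acting on K
  gives \<nu>, L acting on s_H(a) gives f, and s_G(b) acting on s_H(a) gives \<rho>. Compatibility
  with R at s_H(a) gives \<chi>.\<close>

lemma inducible_imp_lifting_cochain:
  assumes "inducible E sH sG \<psi> \<theta>"
  shows "rrb_module_iso A K M (twist_action \<psi> M) \<theta>"
    and "\<exists>\<kappa>\<^sub>1 \<kappa>\<^sub>2. lifting_cochain \<psi> \<theta> \<kappa>\<^sub>1 \<kappa>\<^sub>2"
proof -
  obtain \<gamma> where \<gamma>: "\<gamma> \<in> rrb_auto H"
    and image: "fst \<gamma> ` (inc1 E ` carrier (rH K)) = inc1 E ` carrier (rH K)"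
      "snd \<gamma> ` (inc2 E ` carrier (rG K)) = inc2 E ` carrier (rG K)"
    and on_A: "\<psi> = auto_on_A E sH sG \<gamma>" and on_K: "\<theta> = auto_on_K E \<gamma>"
    using assms by (auto simp: inducible_def rrb_auto_normalizing_def)
  interpret \<gamma>1: group_hom "rH H" "rH H" "fst \<gamma>"
    by unfold_locales (rule autoD[OF rrb_autoD(1)[OF \<gamma>]])
  interpret \<gamma>2: group_hom "rG H" "rG H" "snd \<gamma>"
    by unfold_locales (rule autoD[OF rrb_autoD(2)[OF \<gamma>]])
  have \<psi>_eq: "proj1 E (fst \<gamma> (sH a)) = fst \<psi> a" if "a \<in> carrier (rH A)" for a
    using that by (simp add: on_A auto_on_A_def)
  have \<psi>_eq': "proj2 E (snd \<gamma> (sG b)) = snd \<psi> b" if "b \<in> carrier (rG A)" for b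
    using that by (simp add: on_A auto_on_A_def)
  have \<theta>_eq: "fst \<gamma> (inc1 E k) = inc1 E (fst \<theta> k)" if k: "k \<in> carrier (rH K)" for k
  proof -
    \<comment> \<open>Normalizing K keeps the value in the image of \<open>inc1 E\<close>, where
      \<open>ret1 E\<close> is a genuine inverse.\<close>
    have "fst \<gamma> (inc1 E k) \<in> inc1 E ` carrier (rH K)" using image(1) k by blast
    then show ?thesis using k by (auto simp: on_K auto_on_K_def ret_eq)
  qed
  have \<theta>_eq': "snd \<gamma> (inc2 E l) = inc2 E (snd \<theta> l)" if l: "l \<in> carrier (rG K)" for l
  proof -
    have "snd \<gamma> (inc2 E l) \<in> inc2 E ` carrier (rG K)" using image(2) l by blast
    then show ?thesis using l by (auto simp: on_K auto_on_K_def ret_eq)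
  qed
  define \<kappa>\<^sub>1 where "\<kappa>\<^sub>1 a = X.part (fst \<gamma> (sH a))" for a
  define \<kappa>\<^sub>2 where "\<kappa>\<^sub>2 b = Y.part (snd \<gamma> (sG b))" for b
  have \<kappa>_closed [simp]: "a \<in> carrier (rH A) \<Longrightarrow> \<kappa>\<^sub>1 a \<in> carrier (rH K)"
    "b \<in> carrier (rG A) \<Longrightarrow> \<kappa>\<^sub>2 b \<in> carrier (rG K)" for a b
    by (simp_all add: \<kappa>\<^sub>1_def \<kappa>\<^sub>2_def)
  then have \<kappa>: "\<kappa>\<^sub>1 \<in> carrier (rH A) \<rightarrow> carrier (rH K)" "\<kappa>\<^sub>2 \<in> carrier (rG A) \<rightarrow> carrier (rG K)"
    by auto
  have \<kappa>_one: "\<kappa>\<^sub>1 \<one>\<^bsub>rH A\<^esub> = \<one>\<^bsub>rH K\<^esub>" "\<kappa>\<^sub>2 \<one>\<^bsub>rG A\<^esub> = \<one>\<^bsub>rG K\<^esub>"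
    by (simp_all add: \<kappa>\<^sub>1_def \<kappa>\<^sub>2_def)
  have elt: "fst \<gamma> (X.elt a k) = X.elt (fst \<psi> a) (\<kappa>\<^sub>1 a \<otimes>\<^bsub>rH K\<^esub> fst \<theta> k)"
    if "a \<in> carrier (rH A)" "k \<in> carrier (rH K)" for a k
    using X.hom_elt[OF \<gamma>1.homh that] that by (simp add: \<psi>_eq \<theta>_eq \<kappa>\<^sub>1_def)
  have elt': "snd \<gamma> (Y.elt b l) = Y.elt (snd \<psi> b) (\<kappa>\<^sub>2 b \<otimes>\<^bsub>rG K\<^esub> snd \<theta> l)"
    if "b \<in> carrier (rG A)" "l \<in> carrier (rG K)" for b l
    using Y.hom_elt[OF \<gamma>2.homh that] that by (simp add: \<psi>_eq' \<theta>_eq' \<kappa>\<^sub>2_def)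
  have sec: "fst \<gamma> (sH a) = X.elt (fst \<psi> a) (\<kappa>\<^sub>1 a)" if "a \<in> carrier (rH A)" for a
    using elt[of a "\<one>\<^bsub>rH K\<^esub>"] that by simp
  have sec': "snd \<gamma> (sG b) = Y.elt (snd \<psi> b) (\<kappa>\<^sub>2 b)" if "b \<in> carrier (rG A)" for b
    using elt'[of b "\<one>\<^bsub>rG K\<^esub>"] that by simp
  have phi: "fst \<gamma> (rphi H g h) = rphi H (snd \<gamma> g) (fst \<gamma> h)"
    if "g \<in> carrier (rG H)" "h \<in> carrier (rH H)" for g h
    using rrb_autoD(4)[OF \<gamma>] that by simp
  have nu: "fst \<theta> (act_nu M b k) = act_nu M (snd \<psi> b) (fst \<theta> k)"
    if "b \<in> carrier (rG A)" "k \<in> carrier (rH K)" for b k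
  proof (rule inj_onD[OF X.inj_incl])
    show "inc1 E (fst \<theta> (act_nu M b k)) = inc1 E (act_nu M (snd \<psi> b) (fst \<theta> k))"
      using phi[of "sG b" "inc1 E k"] that
      by (simp add: phi_section_incl \<theta>_eq sec' phi_elt_incl)
  qed (use that in simp_all)
  have f: "fst \<theta> (act_f M l a) = act_f M (snd \<theta> l) (fst \<psi> a)"
    if "l \<in> carrier (rG K)" "a \<in> carrier (rH A)" for l a
  proof -
    have "\<kappa>\<^sub>1 a \<otimes>\<^bsub>rH K\<^esub> fst \<theta> (act_f M l a) = act_f M (snd \<theta> l) (fst \<psi> a) \<otimes>\<^bsub>rH K\<^esub> \<kappa>\<^sub>1 a"
      using phi[of "inc2 E l" "sH a"] that
      by (simp add: phi_incl_section elt \<theta>_eq' sec phi_incl_elt)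
    then show ?thesis using that by (simp add: X.K.m_comm[of "act_f M _ _"])
  qed
  note conjugate = X.hom_elt_conjugate[OF \<gamma>1.homh \<psi>1.homh \<theta>1.homh \<kappa>(1) elt \<kappa>_one(1)]
    Y.hom_elt_conjugate[OF \<gamma>2.homh \<psi>2.homh \<theta>2.homh \<kappa>(2) elt' \<kappa>_one(2)]
  note coc = X.hom_elt_coc[OF \<gamma>1.homh \<psi>1.homh \<theta>1.homh \<kappa>(1) elt \<kappa>_one(1)]
    Y.hom_elt_coc[OF \<gamma>2.homh \<psi>2.homh \<theta>2.homh \<kappa>(2) elt' \<kappa>_one(2)]
  show "rrb_module_iso A K M (twist_action \<psi> M) \<theta>"
    by (simp add: rrb_module_iso_def \<theta> nu f act_mu_eq act_sigma_eq conjugate)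
  have rho: "\<kappa>\<^sub>1 (rphi A b a) \<otimes>\<^bsub>rH K\<^esub> fst \<theta> (rho a b) = rho (fst \<psi> a) (snd \<psi> b)
        \<otimes>\<^bsub>rH K\<^esub> act_nu M (snd \<psi> b) (act_f M (\<kappa>\<^sub>2 b) (fst \<psi> a) \<otimes>\<^bsub>rH K\<^esub> \<kappa>\<^sub>1 a)"
    if "a \<in> carrier (rH A)" "b \<in> carrier (rG A)" for a b
    using phi[of "sG b" "sH a"] that
    by (simp add: phi_section_section elt sec sec' phi_elt del: action_mult)
  have chi: "\<kappa>\<^sub>2 (rR A a) \<otimes>\<^bsub>rG K\<^esub> snd \<theta> (chi a) =
      chi (fst \<psi> a) \<otimes>\<^bsub>rG K\<^esub> rR K (nu_inv K M (snd \<psi> (rR A a)) (\<kappa>\<^sub>1 a))"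
    if "a \<in> carrier (rH A)" for a
    using rrb_autoD(3)[OF \<gamma>, of "sH a"] that
    by (simp add: R_section elt' sec R_elt rrb_autoD(3)[OF \<psi>])
  have "lifting_cochain \<psi> \<theta> \<kappa>\<^sub>1 \<kappa>\<^sub>2"
    unfolding lifting_cochain_def by (intro conjI ballI \<kappa> \<kappa>_one coc rho chi)
  then show "\<exists>\<kappa>\<^sub>1 \<kappa>\<^sub>2. lifting_cochain \<psi> \<theta> \<kappa>\<^sub>1 \<kappa>\<^sub>2" by blast
qed

text \<open>The cochain relations speak of section values only. The module isomorphism relations
  extend them to all normal forms, since they carry the contributions of k and l through \<phi> and
  R separately.\<close>

lemma lifting_cochain_imp_inducible:
  assumes iso: "rrb_module_iso A K M (twist_action \<psi> M) \<theta>"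
    and lifting: "lifting_cochain \<psi> \<theta> \<kappa>\<^sub>1 \<kappa>\<^sub>2"
  shows "inducible E sH sG \<psi> \<theta>"
proof -
  note act = module_iso_action[OF \<psi> iso]
  have \<kappa>: "\<kappa>\<^sub>1 \<in> carrier (rH A) \<rightarrow> carrier (rH K)" "\<kappa>\<^sub>2 \<in> carrier (rG A) \<rightarrow> carrier (rG K)"
    using lifting by (simp_all add: lifting_cochain_def)
  have \<kappa>_closed [simp]: "a \<in> carrier (rH A) \<Longrightarrow> \<kappa>\<^sub>1 a \<in> carrier (rH K)"
    "b \<in> carrier (rG A) \<Longrightarrow> \<kappa>\<^sub>2 b \<in> carrier (rG K)" for a b
    using \<kappa> by auto
  have \<kappa>_one [simp]: "\<kappa>\<^sub>1 \<one>\<^bsub>rH A\<^esub> = \<one>\<^bsub>rH K\<^esub>" "\<kappa>\<^sub>2 \<one>\<^bsub>rG A\<^esub> = \<one>\<^bsub>rG K\<^esub>"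
    using lifting by (simp_all add: lifting_cochain_def)
  have rho: "\<kappa>\<^sub>1 (rphi A b a) \<otimes>\<^bsub>rH K\<^esub> fst \<theta> (rho a b) = rho (fst \<psi> a) (snd \<psi> b)
        \<otimes>\<^bsub>rH K\<^esub> act_nu M (snd \<psi> b) (act_f M (\<kappa>\<^sub>2 b) (fst \<psi> a) \<otimes>\<^bsub>rH K\<^esub> \<kappa>\<^sub>1 a)"
    if "a \<in> carrier (rH A)" "b \<in> carrier (rG A)" for a b
    using lifting that by (simp add: lifting_cochain_def)
  have chi: "\<kappa>\<^sub>2 (rR A a) \<otimes>\<^bsub>rG K\<^esub> snd \<theta> (chi a) =
      chi (fst \<psi> a) \<otimes>\<^bsub>rG K\<^esub> rR K (nu_inv K M (snd \<psi> (rR A a)) (\<kappa>\<^sub>1 a))"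
    if "a \<in> carrier (rH A)" for a
    using lifting that by (simp add: lifting_cochain_def)
  define \<gamma>\<^sub>1 where "\<gamma>\<^sub>1 = X.extend (fst \<psi>) (fst \<theta>) \<kappa>\<^sub>1"
  define \<gamma>\<^sub>2 where "\<gamma>\<^sub>2 = Y.extend (snd \<psi>) (snd \<theta>) \<kappa>\<^sub>2"
  have elt: "\<gamma>\<^sub>1 (X.elt a k) = X.elt (fst \<psi> a) (\<kappa>\<^sub>1 a \<otimes>\<^bsub>rH K\<^esub> fst \<theta> k)"
    if "a \<in> carrier (rH A)" "k \<in> carrier (rH K)" for a k
    using that by (simp add: \<gamma>\<^sub>1_def X.extend_elt)
  have elt': "\<gamma>\<^sub>2 (Y.elt b l) = Y.elt (snd \<psi> b) (\<kappa>\<^sub>2 b \<otimes>\<^bsub>rG K\<^esub> snd \<theta> l)"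
    if "b \<in> carrier (rG A)" "l \<in> carrier (rG K)" for b l
    using that by (simp add: \<gamma>\<^sub>2_def Y.extend_elt)
  have auto1: "\<gamma>\<^sub>1 \<in> auto (rH H)"
    unfolding \<gamma>\<^sub>1_def
    by (rule X.extend_auto[OF rrb_autoD(1)[OF \<psi>] rrb_autoD(1)[OF \<theta>] \<kappa>(1)])
      (use lifting act(2) in \<open>simp_all add: lifting_cochain_def act_mu_eq\<close>)
  have auto2: "\<gamma>\<^sub>2 \<in> auto (rG H)"
    unfolding \<gamma>\<^sub>2_def
    by (rule Y.extend_auto[OF rrb_autoD(2)[OF \<psi>] rrb_autoD(2)[OF \<theta>] \<kappa>(2)])
      (use lifting act(3) in \<open>simp_all add: lifting_cochain_def act_sigma_eq\<close>)
  have R: "\<gamma>\<^sub>2 (rR H h) = rR H (\<gamma>\<^sub>1 h)" if "h \<in> carrier (rH H)" for h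
    using that
  proof (cases rule: X.elt_cases)
    case (1 a k)
    then have "\<gamma>\<^sub>2 (rR H h) = Y.elt (snd \<psi> (rR A a)) (\<kappa>\<^sub>2 (rR A a) \<otimes>\<^bsub>rG K\<^esub> snd \<theta> (chi a)
        \<otimes>\<^bsub>rG K\<^esub> rR K (nu_inv K M (snd \<psi> (rR A a)) (fst \<theta> k)))"
      by (simp add: R_elt elt' Y.K.m_assoc rrb_autoD(3)[OF \<theta>] module_iso_nu_inv[OF \<psi> iso])
    then show ?thesis
      using 1 by (simp add: chi elt R_elt Y.K.m_assoc rrb_autoD(3)[OF \<psi>])
  qed
  have phi: "\<gamma>\<^sub>1 (rphi H g h) = rphi H (\<gamma>\<^sub>2 g) (\<gamma>\<^sub>1 h)"
    if g: "g \<in> carrier (rG H)" and h: "h \<in> carrier (rH H)" for g h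
    using h
  proof (cases rule: X.elt_cases)
    case h: (1 a k)
    from g show ?thesis
    proof (cases rule: Y.elt_cases)
      case g: (1 b l)
      have "\<gamma>\<^sub>1 (rphi H g h) = X.elt (fst \<psi> (rphi A b a)) (\<kappa>\<^sub>1 (rphi A b a) \<otimes>\<^bsub>rH K\<^esub> fst \<theta> (rho a b)
          \<otimes>\<^bsub>rH K\<^esub> act_nu M (snd \<psi> b) (act_f M (snd \<theta> l) (fst \<psi> a) \<otimes>\<^bsub>rH K\<^esub> fst \<theta> k))"
        using g h by (simp add: phi_elt elt X.K.m_assoc act)
      also have "\<dots> = rphi H (\<gamma>\<^sub>2 g) (\<gamma>\<^sub>1 h)"
        \<comment> \<open>The relation for \<rho> brings in f at \<kappa>(b); linearity of f and
          \<nu> merges it with the terms from l and k into the normal form of the right-hand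
          side.\<close>
        using g h by (simp add: rho phi_elt elt elt' X.K.m_ac rrb_autoD(4)[OF \<psi>])
      finally show ?thesis .
    qed
  qed
  have incl: "\<gamma>\<^sub>1 (inc1 E k) = inc1 E (fst \<theta> k)" if "k \<in> carrier (rH K)" for k
    using elt[of "\<one>\<^bsub>rH A\<^esub>" k] that by simp
  have incl': "\<gamma>\<^sub>2 (inc2 E l) = inc2 E (snd \<theta> l)" if "l \<in> carrier (rG K)" for l
    using elt'[of "\<one>\<^bsub>rG A\<^esub>" l] that by simp
  have sec: "\<gamma>\<^sub>1 (sH a) = X.elt (fst \<psi> a) (\<kappa>\<^sub>1 a)" if "a \<in> carrier (rH A)" for a
    using elt[of a "\<one>\<^bsub>rH K\<^esub>"] that by simp
  have sec': "\<gamma>\<^sub>2 (sG b) = Y.elt (snd \<psi> b) (\<kappa>\<^sub>2 b)" if "b \<in> carrier (rG A)" for b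
    using elt'[of b "\<one>\<^bsub>rG K\<^esub>"] that by simp
  have "\<gamma>\<^sub>1 ` (inc1 E ` carrier (rH K)) = inc1 E ` (fst \<theta> ` carrier (rH K))"
    "\<gamma>\<^sub>2 ` (inc2 E ` carrier (rG K)) = inc2 E ` (snd \<theta> ` carrier (rG K))"
    unfolding image_image by (simp_all add: incl incl' cong: image_cong)
  then have "(\<gamma>\<^sub>1, \<gamma>\<^sub>2) \<in> rrb_auto_normalizing E"
    using auto1 auto2 R phi bij_betw_imp_surj_on[OF autoD(2)[OF rrb_autoD(1)[OF \<theta>]]]
      bij_betw_imp_surj_on[OF autoD(2)[OF rrb_autoD(2)[OF \<theta>]]]
    by (simp add: rrb_auto_normalizing_def rrb_auto_def rrb_hom_def autoD(1))
  moreover have "\<psi> = auto_on_A E sH sG (\<gamma>\<^sub>1, \<gamma>\<^sub>2)"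
  proof (rule prod_eqI)
    show "fst \<psi> = fst (auto_on_A E sH sG (\<gamma>\<^sub>1, \<gamma>\<^sub>2))"
      \<comment> \<open>Automorphisms are extensional, so agreement on the carrier suffices; there
        the base coordinate of the lifted section value is \<psi>(a).\<close>
      by (rule extensionalityI[OF autoD(3)[OF rrb_autoD(1)[OF \<psi>]]])
        (simp_all add: auto_on_A_def sec)
    show "snd \<psi> = snd (auto_on_A E sH sG (\<gamma>\<^sub>1, \<gamma>\<^sub>2))"
      by (rule extensionalityI[OF autoD(3)[OF rrb_autoD(2)[OF \<psi>]]])
        (simp_all add: auto_on_A_def sec')
  qed
  moreover have "\<theta> = auto_on_K E (\<gamma>\<^sub>1, \<gamma>\<^sub>2)"
  proof (rule prod_eqI)
    show "fst \<theta> = fst (auto_on_K E (\<gamma>\<^sub>1, \<gamma>\<^sub>2))"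
      by (rule extensionalityI[OF autoD(3)[OF rrb_autoD(1)[OF \<theta>]]])
        (simp_all add: auto_on_K_def incl ret_eq)
    show "snd \<theta> = snd (auto_on_K E (\<gamma>\<^sub>1, \<gamma>\<^sub>2))"
      by (rule extensionalityI[OF autoD(3)[OF rrb_autoD(2)[OF \<theta>]]])
        (simp_all add: auto_on_K_def incl' ret_eq)
  qed
  ultimately show ?thesis unfolding inducible_def by blast
qed

end

end

theorem theorem4p9:
  fixes E :: "('k, 'l, 'h, 'g, 'a, 'b) rrb_ext"
    and sH :: "'a \<Rightarrow> 'h" and sG :: "'b \<Rightarrow> 'g"
    and \<psi> :: "('a \<Rightarrow> 'a) \<times> ('b \<Rightarrow> 'b)"
    and \<theta> :: "('k \<Rightarrow> 'k) \<times> ('l \<Rightarrow> 'l)"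
  assumes "abelian_rrb_extension E"
    and "normalized_sections E sH sG"
    and "\<psi> \<in> rrb_auto (eA E)"
    and "\<theta> \<in> rrb_auto (eK E)"
  shows "inducible E sH sG \<psi> \<theta> \<longleftrightarrow>
    rrb_module_iso (eA E) (eK E) (ext_action E sH sG) (twist_action \<psi> (ext_action E sH sG)) \<theta> \<and>
    theta_star (eA E) (eK E) (ext_action E sH sG) \<psi> \<theta> (ext_class E sH sG) =
      psi_star (eA E) (eK E) (ext_action E sH sG) \<psi> (ext_class E sH sG)"
proof -
  interpret rrb_extension_sections E sH sG by (unfold_locales; fact)
  show ?thesis
    using star_eq_iff_lifting_cochain[OF assms(3,4)] inducible_imp_lifting_cochain[OF assms(3,4)]
      lifting_cochain_imp_inducible[OF assms(3,4)] by blast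
qed

end
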